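(* Let $I=[0,1]$, let $L:\mathbb{R}\times\mathbb{R}\to[0,+\infty]$ be a Borel function, let $1\le p<+\infty$, and let $F(y)=\int_0^1L(y(t),y'(t))\,dt$ for $y\in W^{1,1}(I)$. Let $y\in W^{1,p}(I)$ be such that $y(0)=0$ and $F(y)<+\infty$. Assume that there exist two Lipschitz functions $\rho^-,\rho^+:y(I)\to\mathbb{R}$ such that $$\forall z\in y(I)\qquad \rho^-(z)<0,\quad \rho^+(z)>0,$$ $$\sup_{z\in y(I)}L\big(z,\rho^-(z)\big)<+\infty,\qquad \sup_{z\in y(I)}L\big(z,\rho^+(z)\big)<+\infty.$$ Then there is no Lavrentiev gap at $y$ for the problem (P) of minimizing $F$ over the functions in $W^{1,1}(I)$ vanishing at $0$; that is, there exists a sequence $(y_h)_{h\in\mathbb{N}}$ of functions on $I$ such that: (1) for each $h\in\mathbb{N}$, $y_h$ is Lipschitz and $y_h(0)=0$; (2) $\lim_{h\to+\infty}F(y_h)=F(y)$; (3) $y_h\to y$ in $W^{1,p}(I)$.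
   Context: For $1\le p\le+\infty$, $W^{1,p}(I)$ denotes the space of absolutely continuous functions $y:I\to\mathbb{R}$ with $y'\in L^p(I)$, with its usual norm. The integral defining $F$ takes values in $[0,+\infty]$. *)

theory Defs
  imports "HOL-Analysis.Analysis"
begin

(* A set D of pairs (a, b) stands for a finite family of pairwise disjoint open
   intervals with end points in I. *)
definition abs_continuous_on :: "real set \<Rightarrow> (real \<Rightarrow> real) \<Rightarrow> bool" where
  "abs_continuous_on I f \<longleftrightarrow>
     (\<forall>\<epsilon>>0. \<exists>\<delta>>0. \<forall>D :: (real \<times> real) set.
        finite D \<and> (\<forall>(a, b)\<in>D. a \<in> I \<and> b \<in> I \<and> a < b) \<and>
        disjoint_family_on (\<lambda>(a, b). {a<..<b}) D \<and>
        (\<Sum>(a, b)\<in>D. b - a) < \<delta> \<longrightarrow>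
        (\<Sum>(a, b)\<in>D. \<bar>f b - f a\<bar>) < \<epsilon>)"

(* The pointwise derivative, one-sided at the end points of an interval I. Where f is not
   differentiable the value is unspecified; for absolutely continuous f on an interval this
   happens only on a null set, so the integrals below do not depend on it. *)
definition deriv_on :: "real set \<Rightarrow> (real \<Rightarrow> real) \<Rightarrow> real \<Rightarrow> real" where
  "deriv_on I f t = vector_derivative f (at t within I)"

definition Lp_on :: "real \<Rightarrow> real set \<Rightarrow> (real \<Rightarrow> real) set" where
  "Lp_on p I = {f. f \<in> borel_measurable (lebesgue_on I) \<and>
                   integrable (lebesgue_on I) (\<lambda>t. \<bar>f t\<bar> powr p)}"

definition Lp_norm :: "real \<Rightarrow> real set \<Rightarrow> (real \<Rightarrow> real) \<Rightarrow> real" where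
  "Lp_norm p I f = (LINT t|lebesgue_on I. \<bar>f t\<bar> powr p) powr (1 / p)"

(* W^{1,p}(I) for a compact interval I and finite p. Only the values on I of its members
   matter. *)
definition W1 :: "real \<Rightarrow> real set \<Rightarrow> (real \<Rightarrow> real) set" where
  "W1 p I = {f. abs_continuous_on I f \<and> deriv_on I f \<in> Lp_on p I}"

definition W1_norm :: "real \<Rightarrow> real set \<Rightarrow> (real \<Rightarrow> real) \<Rightarrow> real" where
  "W1_norm p I f = Lp_norm p I f + Lp_norm p I (deriv_on I f)"

(* Membership of the approximants is required because the Bochner integral of a
   non-integrable function is 0. *)
definition W1_tendsto ::
    "real \<Rightarrow> real set \<Rightarrow> (nat \<Rightarrow> real \<Rightarrow> real) \<Rightarrow> (real \<Rightarrow> real) \<Rightarrow> bool" where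
  "W1_tendsto p I u f \<longleftrightarrow> f \<in> W1 p I \<and> (\<forall>h. u h \<in> W1 p I) \<and>
     (\<lambda>h. W1_norm p I (\<lambda>t. u h t - f t)) \<longlonglongrightarrow> 0"

definition action :: "(real \<times> real \<Rightarrow> ennreal) \<Rightarrow> (real \<Rightarrow> real) \<Rightarrow> ennreal" where
  "action L y = (\<integral>\<^sup>+ t. L (y t, deriv_on {0..1} y t) \<partial>lebesgue_on {0..1})"

end

(* Let tau' = 1 where |y'| <= M and tau' = y'/rho(y) where |y'| > M, with rho the one of rho+ and
   rho- that has the sign of y'. If M is at least sup |rho|, then tau' >= 1, so tau(1) >= 1 and
   psi = tau^(-1) is 1-Lipschitz and maps [0,1] into [0,1]. The curve y o psi has slope y'(psi) or
   rho(y(psi)), hence is Lipschitz, and changing variables gives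
     F(y o psi) = int_0^psi(1) L(y, y'/tau') tau' ds,
   which tends to F(y) as M goes to infinity by dominated convergence: on {|y'| > M} the integrand
   is at most sup L(z, rho(z)) * |y'| / inf |rho|. Convergence of the derivatives in L^p
   follows in the same way after approximating y' by continuous functions.
   The a.e. differentiability of absolutely continuous functions is obtained from the Jordan
   decomposition, the Radon-Nikodym theorem and Lebesgue's differentiation theorem. *)

theory Submission
  imports Defs
begin

text \<open>The obstacle is that \<open>L\<close> is merely Borel and may be infinite: nothing is
  known of its values near the pairs (y, y'), so truncating or mollifying y' gives no control of the
  integral. A change of time visits the same values of y and keeps the pair (y, y') wherever the
  slope is small; the only new pairs are (z, rho(z)) with z in y(I), exactly where \<open>L\<close>
  is bounded. Both signs of rho are needed because an increasing change of time cannot reverse the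
  direction of travel. Slowing down costs time, so the new curve may stop before y(1), which is
  harmless since only the value at 0 is prescribed; the delay is at most the integral of tau' - 1,
  which tends to 0. A discontinuous y' composed with psi need not converge pointwise, which is why
  continuous functions enter for the derivatives. All estimates use one Borel function equal to y'
  almost everywhere and to 0 off (0,1]. Then psi is a bijection of the whole line, and the change of
  variables has no boundary terms.\<close>

section \<open>Lebesgue's differentiation theorem on the line\<close>

text \<open>Henstock's lemma bounds the total defect over any finite disjoint family of intervals on which
  the average of \<open>f\<close> is far from its value at the tag; such intervals form a Vitali cover of the
  exceptional set.\<close>

lemma negligible_large_oscillation:
  fixes f :: "real \<Rightarrow> real"
  assumes f: "f integrable_on {a..b}" and k: "k > 0"
  shows "negligible {x \<in> {a..b}. \<forall>d>0. \<exists>u v. a \<le> u \<and> u \<le> x \<and> x \<le> v \<and> v \<le> b \<and> u < v \<and> v - u < d \<and>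
            \<bar>integral {u..v} f - (v - u) * f x\<bar> \<ge> k * (v - u)}" (is "negligible ?S")
  unfolding negligible_outer_le
proof (intro allI impI)
  fix e :: real assume e: "e > 0"
  have fc: "f integrable_on cbox a b" using f by simp
  \<comment> \<open>Each interval of the cover has defect at least \<open>k\<close> times its
    length, so a total defect below \<open>e * k\<close> leaves a total length below
    \<open>e\<close>.\<close>
  have ek: "e * k > 0" using e k by simp
  obtain \<gamma> where \<gamma>: "gauge \<gamma>" and hen: "\<And>p. \<lbrakk>p tagged_partial_division_of (cbox a b); \<gamma> fine p\<rbrakk> \<Longrightarrow>
             (\<Sum>(x,K)\<in>p. norm (measure lborel K *\<^sub>R f x - integral K f)) < e * k"
    by (rule Henstock_lemma[OF fc ek]) (rule that)
  \<comment> \<open>An index keeps its tag, since \<open>x\<close> need not be the centre of the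
    ball \<open>{u..v}\<close> that Vitali's theorem sees; the inclusion in
    \<open>\<gamma> x\<close> makes every subfamily fine for the gauge.\<close>
  define K where "K = {(x, u, v). x \<in> {a..b} \<and> a \<le> u \<and> u \<le> x \<and> x \<le> v \<and> v \<le> b \<and> u < v \<and> {u..v} \<subseteq> \<gamma> x \<and>
            \<bar>integral {u..v} f - (v - u) * f x\<bar> \<ge> k * (v - u)}"
  define c :: "real \<times> real \<times> real \<Rightarrow> real" where "c = (\<lambda>(x, u, v). (u + v) / 2)"
  define r :: "real \<times> real \<times> real \<Rightarrow> real" where "r = (\<lambda>(x, u, v). (v - u) / 2)"
  have ball: "cball (c (x, u, v)) (r (x, u, v)) = {u..v}" for x u v
    by (auto simp: c_def r_def cball_eq_atLeastAtMost field_simps)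
  have rpos: "0 < r i" if "i \<in> K" for i
    using that by (auto simp: K_def r_def)
  have cover: "\<exists>i. i \<in> K \<and> x \<in> cball (c i) (r i) \<and> r i < d" if x: "x \<in> ?S" and d: "d > 0" for x d
  proof -
    from gaugeD[OF \<gamma>, of x] obtain \<delta> where \<delta>: "\<delta> > 0" "cball x \<delta> \<subseteq> \<gamma> x"
      by (meson open_contains_cball)
    have "min d \<delta> > 0" using d \<delta> by simp
    then obtain u v where uv: "a \<le> u" "u \<le> x" "x \<le> v" "v \<le> b" "u < v" "v - u < min d \<delta>"
       "\<bar>integral {u..v} f - (v - u) * f x\<bar> \<ge> k * (v - u)"
      using x by blast
    have "{u..v} \<subseteq> cball x \<delta>" using uv by (auto simp: dist_real_def)
    then have "(x, u, v) \<in> K" using uv \<delta> x unfolding K_def by auto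
    moreover have "x \<in> cball (c (x, u, v)) (r (x, u, v))" unfolding ball using uv by auto
    moreover have "r (x, u, v) < d" using uv by (auto simp: r_def)
    ultimately show ?thesis by blast
  qed
  obtain C where C: "countable C" "C \<subseteq> K"
     "pairwise (\<lambda>i j. disjnt (cball (c i) (r i)) (cball (c j) (r j))) C"
     "negligible (?S - (\<Union>i \<in> C. cball (c i) (r i)))"
    by (rule Vitali_covering_theorem_cballs[of K r ?S c, OF rpos cover]) (auto simp: that)
  have fin: "measure lebesgue (\<Union>i\<in>D. cball (c i) (r i)) \<le> e" if D: "D \<subseteq> C" "finite D" for D
  proof -
    define h where "h = (\<lambda>(x::real, u::real, v::real). (x, {u..v}))"
    have disj: "disjnt (cball (c i) (r i)) (cball (c j) (r j))" if "i \<in> D" "j \<in> D" "i \<noteq> j" for i j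
      using C(3) D(1) that by (meson pairwiseD subsetD)
    have DK: "D \<subseteq> K" using C D by auto
    have inj: "inj_on h D"
      using DK by (auto simp: inj_on_def h_def K_def)
    have tag: "h ` D tagged_partial_division_of (cbox a b)"
      unfolding tagged_partial_division_of_def
    proof (intro conjI allI impI)
      show "finite (h ` D)" using D by simp
    next
      fix x S assume "(x, S) \<in> h ` D"
      then obtain u v where uv: "(x,u,v) \<in> D" "S = {u..v}" by (auto simp: h_def)
      with DK have "a \<le> u" "u \<le> x" "x \<le> v" "v \<le> b" by (auto simp: K_def)
      then show "x \<in> S" "S \<subseteq> cbox a b" using uv by auto
      show "\<exists>a b. S = cbox a b" unfolding uv(2) cbox_interval[symmetric] by blast
    next
      fix x1 K1 x2 K2 assume *: "(x1, K1) \<in> h ` D \<and> (x2, K2) \<in> h ` D \<and> (x1, K1) \<noteq> (x2, K2)"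
      then obtain u1 v1 u2 v2 where "(x1,u1,v1) \<in> D" "K1 = {u1..v1}" "(x2,u2,v2) \<in> D" "K2 = {u2..v2}"
        by (auto simp: h_def)
      with disj[of "(x1,u1,v1)" "(x2,u2,v2)"] * have "K1 \<inter> K2 = {}"
        unfolding ball disjnt_def by auto
      then show "interior K1 \<inter> interior K2 = {}"
        using interior_subset by blast
    qed
    have fine: "\<gamma> fine h ` D"
      using DK by (auto simp: fine_def h_def K_def)
    have "measure lebesgue (\<Union>i\<in>D. cball (c i) (r i)) = (\<Sum>i\<in>D. measure lebesgue (cball (c i) (r i)))"
    proof (rule measure_negligible_finite_Union_image)
      show "pairwise (\<lambda>x y. negligible (cball (c x) (r x) \<inter> cball (c y) (r y))) D"
        using disj by (simp add: pairwise_def disjnt_def)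
    qed (use D in auto)
    also have "k * \<dots> \<le> (\<Sum>i\<in>D. (\<lambda>(x,K). norm (measure lborel K *\<^sub>R f x - integral K f)) (h i))"
      unfolding sum_distrib_left
    proof (rule sum_mono)
      fix i assume "i \<in> D"
      then obtain x u v where i: "i = (x,u,v)" "(x,u,v) \<in> K" using DK by (cases i) auto
      then show "k * measure lebesgue (cball (c i) (r i)) \<le> (case h i of (x, K) \<Rightarrow> norm (measure lborel K *\<^sub>R f x - integral K f))"
        unfolding i(1) ball h_def by (auto simp: K_def measure_lborel_Icc abs_minus_commute)
    qed
    also have "\<dots> = (\<Sum>(x,K)\<in>h ` D. norm (measure lborel K *\<^sub>R f x - integral K f))"
      by (subst sum.reindex[OF inj]) (simp add: o_def)
    also have "\<dots> < e * k" by (rule hen[OF tag fine])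
    finally show ?thesis using k by (simp add: mult.commute)
  qed
  let ?\<D> = "(\<lambda>i. cball (c i) (r i)) ` C"
  let ?N = "?S - (\<Union>i \<in> C. cball (c i) (r i))"
  \<comment> \<open>The bound \<open>e\<close> is uniform over finite subfamilies, hence passes to
    the countable union.\<close>
  have fin': "measure lebesgue (\<Union>D') \<le> e" if "D' \<subseteq> ?\<D>" "finite D'" for D'
    using finite_subset_image[OF that(2,1)] fin by auto
  have meas: "\<Union>?\<D> \<in> lmeasurable" "measure lebesgue (\<Union>?\<D>) \<le> e"
  proof -
    have 1: "\<And>D. D \<in> ?\<D> \<Longrightarrow> D \<in> lmeasurable" by auto
    have 2: "measure lebesgue (\<Union>D') \<le> e" if "D' \<subseteq> ?\<D>" "finite D'" for D' using fin' that by blast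
    show "\<Union>?\<D> \<in> lmeasurable"
      by (rule fmeasurable_Union_bound[of ?\<D> lebesgue e]) (use 1 2 C(1) in auto)
    show "measure lebesgue (\<Union>?\<D>) \<le> e"
      by (rule measure_Union_bound[of ?\<D> lebesgue e]) (use 1 2 C(1) in auto)
  qed
  have "?N \<union> \<Union>?\<D> \<in> lmeasurable"
    using meas C(4) by (intro fmeasurable.Un) (auto intro: negligible_imp_measurable)
  moreover have "measure lebesgue (?N \<union> \<Union>?\<D>) \<le> e"
    using meas C(4) measure_Un_le[of ?N lebesgue "\<Union>?\<D>"] negligible_imp_measure0[OF C(4)]
      negligible_imp_sets[OF C(4)] by auto
  ultimately show "\<exists>T. ?S \<subseteq> T \<and> T \<in> lmeasurable \<and> measure lebesgue T \<le> e"
    by (intro exI[of _ "?N \<union> \<Union>?\<D>"]) auto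
qed

text \<open>Links the Bochner integral over half-lines, which gives one primitive on the whole line,
  with the gauge integral of Henstock's lemma; \<open>{u<..v}\<close> and \<open>{u..v}\<close>
  differ by one point.\<close>

lemma has_integral_indefinite_diff:
  fixes f :: "real \<Rightarrow> real"
  assumes f: "integrable lborel f" and uv: "u \<le> v"
  shows "(f has_integral (LINT s:{..v}|lborel. f s) - (LINT s:{..u}|lborel. f s)) {u..v}"
    and "(LINT s:{..v}|lborel. f s) - (LINT s:{..u}|lborel. f s) = (LINT s:{u<..v}|lborel. f s)"
proof -
  have si: "set_integrable lborel A f" if "A \<in> sets borel" for A
    unfolding set_integrable_def using f that by (intro integrable_mult_indicator) auto
  have "{..v} = {..u} \<union> {u<..v}" using uv by auto
  then have "(LINT s:{..v}|lborel. f s) = (LINT s:{..u}|lborel. f s) + (LINT s:{u<..v}|lborel. f s)"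
    by (simp only:) (rule set_integral_Un, auto intro: si)
  then show *: "(LINT s:{..v}|lborel. f s) - (LINT s:{..u}|lborel. f s) = (LINT s:{u<..v}|lborel. f s)"
    by simp
  have "(LINT s:{u<..v}|lborel. f s) = (LINT s:{u..v}|lborel. f s)"
  proof (rule set_integral_null_delta[OF f])
    have "finite (({u<..v} - {u..v}) \<union> ({u..v} - {u<..v}))"
      by (rule finite_subset[of _ "{u}"]) auto
    then show "({u<..v} - {u..v}) \<union> ({u..v} - {u<..v}) \<in> null_sets lborel"
      by (rule finite_imp_null_set_lborel)
  qed auto
  also have "\<dots> = integral {u..v} f"
    by (rule set_borel_integral_eq_integral(2)[OF si]) simp
  finally show "(f has_integral (LINT s:{..v}|lborel. f s) - (LINT s:{..u}|lborel. f s)) {u..v}"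
    unfolding * using set_borel_integral_eq_integral(1)[OF si, of "{u..v}"] by (simp add: has_integral_integral)
qed

lemma continuous_on_indefinite:
  fixes f :: "real \<Rightarrow> real"
  assumes f: "integrable lborel f"
  shows "continuous_on UNIV (\<lambda>t. LINT s:{..t}|lborel. f s)"
proof -
  let ?F = "\<lambda>t. LINT s:{..t}|lborel. f s"
  have "isCont ?F x" for x
  proof -
    have eq: "?F (x - 1) + integral {x - 1..t} f = ?F t" if "t \<in> {x - 1..x + 1}" for t
      using has_integral_indefinite_diff(1)[OF f, of "x - 1" t] that by (simp add: integral_unique)
    have "continuous_on {x - 1..x + 1} (\<lambda>t. integral {x - 1..t} f)"
      by (intro indefinite_integral_continuous_1) (rule has_integral_integrable[OF has_integral_indefinite_diff(1)[OF f]], simp)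
    then have "continuous_on {x - 1..x + 1} (\<lambda>t. ?F (x - 1) + integral {x - 1..t} f)"
      by (intro continuous_intros)
    then have "continuous_on {x - 1..x + 1} ?F" by (rule continuous_on_eq) (rule eq)
    then show ?thesis by (rule continuous_on_interior) auto
  qed
  then show ?thesis by (simp add: continuous_on_eq_continuous_at)
qed

text \<open>If the primitive does not have derivative \<open>f x\<close> at \<open>x\<close>, then
  for some \<open>k\<close> there are arbitrarily short intervals with end point \<open>x\<close> on
  which the mean of \<open>f\<close> differs from \<open>f x\<close> by at least
  \<open>1 / (k + 1)\<close>. So \<open>x\<close> lies in one of the countably many negligible sets
  \<open>S n k\<close>.\<close>

theorem Lebesgue_differentiation:
  fixes f :: "real \<Rightarrow> real"
  assumes f: "integrable lborel f"
  shows "AE x in lborel. ((\<lambda>u. LINT s:{..u}|lborel. f s) has_real_derivative f x) (at x)"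
proof -
  define F where "F = (\<lambda>u. LINT s:{..u}|lborel. f s)"
  define S where "S n k = {x \<in> {-real n..real n}. \<forall>d>0. \<exists>u v. -real n \<le> u \<and> u \<le> x \<and> x \<le> v \<and> v \<le> real n \<and> u < v \<and> v - u < d \<and>
            \<bar>integral {u..v} f - (v - u) * f x\<bar> \<ge> inverse (real (Suc k)) * (v - u)}" for n k
  have Fd: "F v - F u = integral {u..v} f" "f integrable_on {u..v}" if "u \<le> v" for u v
    using has_integral_indefinite_diff(1)[OF f that] unfolding F_def by (auto simp: integral_unique has_integral_integrable)
  have f_int: "f integrable_on {-real n..real n}" for n
    by (rule Fd) simp
  have "negligible (S n k)" for n k
    unfolding S_def by (rule negligible_large_oscillation[OF f_int]) simp
  then have "negligible (\<Union>n. \<Union>k. S n k)"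
    by (intro negligible_countable_Union) auto
  then have "AE x in lebesgue. x \<notin> (\<Union>n. \<Union>k. S n k)"
    unfolding negligible_iff_null_sets by (rule AE_not_in)
  then have "AE x in lborel. x \<notin> (\<Union>n. \<Union>k. S n k)"
    by (simp only: AE_completion_iff)
  then show ?thesis
  proof eventually_elim
    case (elim x)
    obtain n where n: "\<bar>x\<bar> < real n" using reals_Archimedean2 by blast
    have "(F has_real_derivative f x) (at x)"
      unfolding has_field_derivative_iff tendsto_iff
    proof (intro allI impI)
      fix e :: real assume "e > 0"
      then obtain k where k: "inverse (real (Suc k)) < e" using reals_Archimedean by blast
      let ?i = "inverse (real (Suc k))"
      have "x \<notin> S n k" using elim by blast
      then obtain d where d: "d > 0" and d2: "\<And>u v. \<lbrakk>-real n \<le> u; u \<le> x; x \<le> v; v \<le> real n; u < v; v - u < d\<rbrakk> \<Longrightarrow>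
            \<bar>integral {u..v} f - (v - u) * f x\<bar> < ?i * (v - u)"
        using n unfolding S_def by fastforce
      \<comment> \<open>Keeps \<open>y\<close> inside \<open>{-n..n}\<close>, where the intervals of
        \<open>S n k\<close> live.\<close>
      define d' where "d' = min d (real n - \<bar>x\<bar>)"
      have "d' > 0" using n d by (simp add: d'_def)
      show "\<forall>\<^sub>F y in at x. dist ((F y - F x) / (y - x)) (f x) < e"
        unfolding eventually_at
      proof (intro exI[of _ d'] conjI ballI impI)
        fix y assume y: "y \<noteq> x \<and> dist y x < d'"
        have "\<bar>F y - F x - (y - x) * f x\<bar> < ?i * \<bar>y - x\<bar>"
        proof (cases "y > x")
          case True
          then show ?thesis using d2[of x y] y n Fd(1)[of x y] by (auto simp: d'_def dist_real_def)
        next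
          case False
          then have "y < x" using y by auto
          then show ?thesis using d2[of y x] y n Fd(1)[of y x] by (auto simp: d'_def dist_real_def algebra_simps abs_if split: if_splits)
        qed
        moreover have "(F y - F x) / (y - x) - f x = (F y - F x - (y - x) * f x) / (y - x)"
          using y by (simp add: field_simps)
        ultimately have "\<bar>(F y - F x) / (y - x) - f x\<bar> < ?i"
          using y by (simp only: abs_divide) (subst pos_divide_less_eq, auto)
        then show "dist ((F y - F x) / (y - x)) (f x) < e" using k by (simp add: dist_real_def)
      qed (use \<open>d' > 0\<close> in auto)
    qed
    then show ?case unfolding F_def .
  qed
qed

section \<open>Absolutely continuous functions\<close>

text \<open>The families over which \<open>abs_continuous_on\<close> quantifies, without the bound
  on their length, so that cutting and merging them can be treated separately.\<close>

definition interval_family :: "real set \<Rightarrow> (real \<times> real) set \<Rightarrow> bool" where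
  "interval_family S D \<longleftrightarrow> finite D \<and> (\<forall>(a, b)\<in>D. a \<in> S \<and> b \<in> S \<and> a < b) \<and>
     disjoint_family_on (\<lambda>(a, b). {a<..<b}) D"

lemma abs_continuous_onD:
  assumes "abs_continuous_on S f" "\<epsilon> > 0"
  obtains \<delta> where "\<delta> > 0" "\<And>D. interval_family S D \<Longrightarrow> (\<Sum>(a, b)\<in>D. b - a) < \<delta> \<Longrightarrow> (\<Sum>(a, b)\<in>D. \<bar>f b - f a\<bar>) < \<epsilon>"
proof -
  have "\<exists>\<delta>>0. \<forall>D. interval_family S D \<and> (\<Sum>(a, b)\<in>D. b - a) < \<delta> \<longrightarrow> (\<Sum>(a, b)\<in>D. \<bar>f b - f a\<bar>) < \<epsilon>"
    using assms(1)[unfolded abs_continuous_on_def, rule_format, OF assms(2)]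
    unfolding interval_family_def by (simp only: conj_assoc)
  then show thesis using that by auto
qed

text \<open>Moving end points may collapse intervals, and collapsed ones may coincide, while a
  family is a set. Discarding them leaves nonempty disjoint intervals, hence distinct pairs, and
  \<open>g x x = 0\<close> makes the discarded terms vanish. One family serves all \<open>g\<close>,
  so that lengths and increments are transferred together.\<close>

lemma interval_family_image:
  fixes l r :: "'i \<Rightarrow> real"
  assumes "finite I" and lr: "\<And>i. i \<in> I \<Longrightarrow> l i \<in> S \<and> r i \<in> S \<and> l i \<le> r i"
    and disj: "disjoint_family_on (\<lambda>i. {l i<..<r i}) I"
  obtains D where "interval_family S D"
    "\<And>g :: real \<Rightarrow> real \<Rightarrow> real. (\<And>x. g x x = 0) \<Longrightarrow> (\<Sum>(a, b)\<in>D. g a b) = (\<Sum>i\<in>I. g (l i) (r i))"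
proof -
  define J where "J = {i \<in> I. l i < r i}"
  define D where "D = (\<lambda>i. (l i, r i)) ` J"
  have ne: "i = j" if "i \<in> J" "j \<in> J" "l i = l j" "r i = r j" for i j
  proof (rule ccontr)
    assume "i \<noteq> j"
    then have "{l i<..<r i} \<inter> {l j<..<r j} = {}"
      using disj that unfolding disjoint_family_on_def J_def by blast
    moreover have "{l i<..<r i} \<noteq> {}" using that(1) by (auto simp: J_def)
    ultimately show False using that by simp
  qed
  then have inj: "inj_on (\<lambda>i. (l i, r i)) J" by (auto simp: inj_on_def)
  have "disjoint_family_on (\<lambda>(a, b). {a<..<b}) D"
    unfolding disjoint_family_on_def D_def using disj[unfolded disjoint_family_on_def]
    by (fastforce simp: J_def)
  then have "interval_family S D"
    using assms(1) lr unfolding interval_family_def by (auto simp: D_def J_def)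
  moreover have "(\<Sum>(a, b)\<in>D. g a b) = (\<Sum>i\<in>I. g (l i) (r i))" if "\<And>x. g x x = 0" for g :: "real \<Rightarrow> real \<Rightarrow> real"
  proof -
    have "(\<Sum>(a, b)\<in>D. g a b) = (\<Sum>i\<in>J. g (l i) (r i))"
      unfolding D_def by (subst sum.reindex[OF inj]) simp
    also have "\<dots> = (\<Sum>i\<in>I. g (l i) (r i))"
    proof (rule sum.mono_neutral_left)
      show "\<forall>i\<in>I - J. g (l i) (r i) = 0"
        using that lr by (force simp: J_def)
    qed (use assms(1) in \<open>auto simp: J_def\<close>)
    finally show ?thesis .
  qed
  ultimately show thesis using that by blast
qed

lemma interval_family_length:
  assumes D: "interval_family {s..t} D" and "s \<le> t"
  shows "(\<Sum>(a, b)\<in>D. b - a) \<le> t - s"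
proof -
  have "(\<Sum>(a, b)\<in>D. b - a) = (\<Sum>i\<in>D. measure lborel (case i of (a, b) \<Rightarrow> {a<..<b}))"
    using D by (intro sum.cong) (auto simp: interval_family_def)
  also have "\<dots> = measure lborel (\<Union>i\<in>D. case i of (a, b) \<Rightarrow> {a<..<b})"
    using D by (intro measure_finite_Union[symmetric]) (auto simp: interval_family_def split: prod.splits)
  also have "\<dots> \<le> measure lborel {s..t}"
  proof (rule measure_mono_fmeasurable)
    show "(\<Union>i\<in>D. case i of (a, b) \<Rightarrow> {a<..<b}) \<subseteq> {s..t}"
    proof
      fix x assume "x \<in> (\<Union>i\<in>D. case i of (a, b) \<Rightarrow> {a<..<b})"
      then obtain a b where "(a, b) \<in> D" "a < x" "x < b" by auto
      moreover from this have "s \<le> a" "b \<le> t" using D by (auto simp: interval_family_def)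
      ultimately show "x \<in> {s..t}" by simp
    qed
    show "(\<Union>i\<in>D. case i of (a, b) \<Rightarrow> {a<..<b}) \<in> sets lborel"
      using D by (intro sets.finite_UN) (auto simp: interval_family_def split: prod.splits)
    show "{s..t} \<in> fmeasurable lborel" by (rule fmeasurableI) (simp_all add: emeasure_lborel_Icc_eq)
  qed
  finally show ?thesis using \<open>s \<le> t\<close> by simp
qed

section \<open>Variation of an absolutely continuous function\<close>

text \<open>Cut \<open>{0..1}\<close> into \<open>N\<close> pieces shorter than the
  \<open>\<delta>\<close> that belongs to 1. The traces of a family on one piece have total
  increment below 1, so the variation is at most \<open>N\<close>.\<close>

lemma abs_continuous_on_bounded_variation:
  assumes ac: "abs_continuous_on {0..1} f"
  obtains B where "\<And>D. interval_family {0..1} D \<Longrightarrow> (\<Sum>(a, b)\<in>D. \<bar>f b - f a\<bar>) \<le> B"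
proof -
  obtain \<delta> where \<delta>: "\<delta> > 0" "\<And>D. interval_family {0..1} D \<Longrightarrow> (\<Sum>(a, b)\<in>D. b - a) < \<delta> \<Longrightarrow> (\<Sum>(a, b)\<in>D. \<bar>f b - f a\<bar>) < 1"
    using abs_continuous_onD[OF ac, of 1] by auto
  obtain N0 where N0: "inverse (real (Suc N0)) < \<delta>" using reals_Archimedean \<open>\<delta> > 0\<close> by blast
  define N where "N = Suc N0"
  define T where "T j = real j / real N" for j
  \<comment> \<open>Clamping to the \<open>j\<close>-th piece cuts an interval to its trace there
    and collapses it if it lies outside.\<close>
  define cl where "cl j x = max (T j) (min x (T (Suc j)))" for j x
  have T: "T j \<le> T (Suc j)" "0 \<le> T j" "T (Suc j) - T j = inverse (real N)" for j
    by (auto simp: T_def N_def field_simps)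
  have T1: "T j \<le> 1" if "j \<le> N" for j using that by (auto simp: T_def N_def field_simps)
  \<comment> \<open>Each term becomes a difference between \<open>j + 1\<close> and \<open>j\<close>
    of the increment of \<open>f (min x (T j))\<close> from \<open>c\<close> to \<open>d\<close>, so
    the sum telescopes without locating the pieces that contain \<open>c\<close> and
    \<open>d\<close>; at \<open>T 0 = 0\<close> the increment is 0.\<close>
  have tel: "f d - f c = (\<Sum>j<N. f (cl j d) - f (cl j c))" if "0 \<le> c" "c \<le> d" "d \<le> 1" for c d
  proof -
    have "f (cl j x) = f (min x (T (Suc j))) - f (min x (T j)) + f (T j)" for j x
    proof (cases "x \<le> T j")
      case True
      then have "cl j x = T j" "min x (T (Suc j)) = x" "min x (T j) = x" using T(1)[of j] by (auto simp: cl_def)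
      then show ?thesis by simp
    next
      case False
      then have "cl j x = min x (T (Suc j))" "min x (T j) = T j" using T(1)[of j] by (auto simp: cl_def)
      then show ?thesis by simp
    qed
    then have "f (cl j d) - f (cl j c) = (f (min d (T (Suc j))) - f (min c (T (Suc j)))) - (f (min d (T j)) - f (min c (T j)))" for j
      by simp
    then have "(\<Sum>j<N. f (cl j d) - f (cl j c)) = (f (min d (T N)) - f (min c (T N))) - (f (min d (T 0)) - f (min c (T 0)))"
      using sum_lessThan_telescope[of "\<lambda>j. f (min d (T j)) - f (min c (T j))" N] by simp
    also have "\<dots> = f d - f c" using that by (simp add: T_def N_def)
    finally show ?thesis by simp
  qed
  have "(\<Sum>(a, b)\<in>D. \<bar>f b - f a\<bar>) \<le> real N" if D: "interval_family {0..1} D" for D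
  proof -
    have fin: "finite D" using D by (simp add: interval_family_def)
    have one: "(\<Sum>(a, b)\<in>D. \<bar>f (cl j b) - f (cl j a)\<bar>) \<le> 1" if j: "j < N" for j
    proof -
      have clm: "cl j a \<le> cl j b" "cl j a \<in> {T j..T (Suc j)}" if "a \<le> b" for a b
        using that T(1)[of j] by (auto simp: cl_def)
      obtain E where E: "interval_family {T j..T (Suc j)} E"
        "\<And>g :: real \<Rightarrow> real \<Rightarrow> real. (\<And>x. g x x = 0) \<Longrightarrow> (\<Sum>(a, b)\<in>E. g a b) = (\<Sum>i\<in>D. g (cl j (fst i)) (cl j (snd i)))"
      proof (rule interval_family_image[OF fin, of "\<lambda>i. cl j (fst i)" "{T j..T (Suc j)}" "\<lambda>i. cl j (snd i)"])
        show "cl j (fst i) \<in> {T j..T (Suc j)} \<and> cl j (snd i) \<in> {T j..T (Suc j)} \<and> cl j (fst i) \<le> cl j (snd i)" if "i \<in> D" for i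
          using D that clm[of "fst i" "snd i"] clm(2)[of "snd i" "snd i"] by (auto simp: interval_family_def)
        show "disjoint_family_on (\<lambda>i. {cl j (fst i)<..<cl j (snd i)}) D"
        proof (rule disjoint_family_on_bisimulation)
          show "disjoint_family_on (\<lambda>(a, b). {a<..<b}) D" using D by (simp add: interval_family_def)
          fix m n assume "m \<in> D" "n \<in> D" "m \<noteq> n" and dis: "(case m of (a, b) \<Rightarrow> {a<..<b}) \<inter> (case n of (a, b) \<Rightarrow> {a<..<b}) = {}"
          have sub: "{cl j (fst i)<..<cl j (snd i)} \<subseteq> (case i of (a, b) \<Rightarrow> {a<..<b})" for i
            by (cases i) (auto simp: cl_def)
          show "{cl j (fst m)<..<cl j (snd m)} \<inter> {cl j (fst n)<..<cl j (snd n)} = {}"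
            using sub[of m] sub[of n] dis by blast
        qed
      qed blast
      have "(\<Sum>(a, b)\<in>E. b - a) < \<delta>"
        using interval_family_length[OF E(1)] T[of j] N0 by (simp add: N_def)
      moreover have "{T j..T (Suc j)} \<subseteq> {0..1}"
        using T(2)[of j] T1[of "Suc j"] j by auto
      then have "interval_family {0..1} E"
        using E(1) unfolding interval_family_def by blast
      ultimately have "(\<Sum>(a, b)\<in>E. \<bar>f b - f a\<bar>) < 1" by (rule \<delta>(2)[rotated])
      also have "(\<Sum>(a, b)\<in>E. \<bar>f b - f a\<bar>) = (\<Sum>(a, b)\<in>D. \<bar>f (cl j b) - f (cl j a)\<bar>)"
        using E(2)[of "\<lambda>a b. \<bar>f b - f a\<bar>"] by (simp add: case_prod_unfold)
      finally show ?thesis by simp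
    qed
    have "(\<Sum>(a, b)\<in>D. \<bar>f b - f a\<bar>) \<le> (\<Sum>(a, b)\<in>D. \<Sum>j<N. \<bar>f (cl j b) - f (cl j a)\<bar>)"
    proof (rule sum_mono)
      fix i assume "i \<in> D"
      then have "0 \<le> fst i" "fst i \<le> snd i" "snd i \<le> 1" using D by (auto simp: interval_family_def)
      from tel[OF this] show "(case i of (a, b) \<Rightarrow> \<bar>f b - f a\<bar>) \<le> (case i of (a, b) \<Rightarrow> \<Sum>j<N. \<bar>f (cl j b) - f (cl j a)\<bar>)"
        by (simp add: case_prod_unfold sum_abs)
    qed
    also have "\<dots> = (\<Sum>j<N. \<Sum>(a, b)\<in>D. \<bar>f (cl j b) - f (cl j a)\<bar>)"
      unfolding case_prod_unfold by (rule sum.swap)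
    also have "\<dots> \<le> (\<Sum>j<N. 1)" using one by (intro sum_mono) simp
    finally show ?thesis by simp
  qed
  then show thesis using that by blast
qed

lemma disjoint_family_on_shrink:
  fixes l r :: "'i \<Rightarrow> real"
  assumes "disjoint_family_on A I" "\<And>i. i \<in> I \<Longrightarrow> {l i<..<r i} \<subseteq> A i"
  shows "disjoint_family_on (\<lambda>i. {l i<..<r i}) I"
  using assms unfolding disjoint_family_on_def by blast

lemma interval_family_disjoint:
  "interval_family S D \<Longrightarrow> disjoint_family_on (\<lambda>i. {fst i<..<snd i}) D"
  by (simp add: interval_family_def case_prod_unfold)

text \<open>\<open>V t\<close> is the variation of \<open>f\<close> on \<open>[0,t]\<close>. For its absolute continuity, each increment of \<open>V\<close> is
  nearly attained by a family in \<open>[0,b]\<close>, of which only the parts cut off to the right of \<open>a\<close>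
  count; all the cut families together are again one disjoint family of small length.\<close>

lemma abs_continuous_on_variation:
  assumes ac: "abs_continuous_on {0..1} f"
  obtains V where "abs_continuous_on {0..1} V"
    "\<And>s t. 0 \<le> s \<Longrightarrow> s \<le> t \<Longrightarrow> t \<le> 1 \<Longrightarrow> \<bar>f t - f s\<bar> \<le> V t - V s"
proof -
  obtain B where B: "\<And>D. interval_family {0..1} D \<Longrightarrow> (\<Sum>(a, b)\<in>D. \<bar>f b - f a\<bar>) \<le> B"
    using abs_continuous_on_bounded_variation[OF ac] by blast
  define W where "W D = (\<Sum>(a, b)\<in>D. \<bar>f b - f a\<bar>)" for D
  define V where "V t = (SUP D\<in>Collect (interval_family {0..t}). W D)" for t
  have bdd: "bdd_above (W ` Collect (interval_family {0..t}))" if "t \<le> 1" for t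
  proof -
    have "interval_family {0..1} D" if "interval_family {0..t} D" for D
      using that \<open>t \<le> 1\<close> by (auto simp: interval_family_def)
    then show ?thesis using B unfolding W_def by (intro bdd_aboveI2[of _ _ B]) auto
  qed
  have upper: "W D \<le> V t" if "interval_family {0..t} D" "t \<le> 1" for t D
    unfolding V_def using bdd[OF that(2)] that(1) by (intro cSUP_upper) auto
  \<comment> \<open>The supremum in \<open>V t\<close> is taken over a nonempty set, as its
    least-upper-bound property requires.\<close>
  have empty: "interval_family {0..t} {}" for t by (simp add: interval_family_def disjoint_family_on_def)
  have least: "V t \<le> x" if "\<And>D. interval_family {0..t} D \<Longrightarrow> W D \<le> x" for t x
    unfolding V_def using empty that by (intro cSUP_least) auto
  have V: "\<bar>f t - f s\<bar> \<le> V t - V s" if st: "0 \<le> s" "s \<le> t" "t \<le> 1" for s t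
  proof (cases "s = t")
    case False
    \<comment> \<open>Any family in \<open>{0..s}\<close> can be extended by the pair
      \<open>(s, t)\<close>, which adds \<open>\<bar>f t - f s\<bar>\<close> to its sum.\<close>
    have "V s \<le> V t - \<bar>f t - f s\<bar>"
    proof (rule least)
      fix D assume D: "interval_family {0..s} D"
      have sub: "0 \<le> fst i \<and> fst i < snd i \<and> snd i \<le> s" if "i \<in> D" for i using D that by (auto simp: interval_family_def)
      have nin: "(s, t) \<notin> D" using sub[of "(s,t)"] False st by auto
      have dj: "disjoint_family_on (\<lambda>i. {fst i<..<snd i}) (insert (s, t) D)"
        unfolding disjoint_family_on_insert[OF nin]
      proof
        show "{fst (s, t)<..<snd (s, t)} \<inter> (\<Union>i\<in>D. {fst i<..<snd i}) = {}" using sub by force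
      qed (rule interval_family_disjoint[OF D])
      have "\<forall>i \<in> insert (s,t) D. fst i \<in> {0..t} \<and> snd i \<in> {0..t} \<and> fst i < snd i"
        using sub st False by force
      then have "interval_family {0..t} (insert (s, t) D)"
        using dj D by (simp add: interval_family_def case_prod_unfold)
      then have "W (insert (s, t) D) \<le> V t" using upper st by blast
      moreover have "W (insert (s, t) D) = \<bar>f t - f s\<bar> + W D"
        using D nin by (simp add: W_def interval_family_def)
      ultimately show "W D \<le> V t - \<bar>f t - f s\<bar>" by simp
    qed
    then show ?thesis by simp
  qed simp
  have "abs_continuous_on {0..1} V"
    unfolding abs_continuous_on_def
  proof (intro allI impI)
    fix \<epsilon> :: real assume "\<epsilon> > 0"
    then obtain \<delta> where \<delta>: "\<delta> > 0" "\<And>D. interval_family {0..1} D \<Longrightarrow> (\<Sum>(a, b)\<in>D. b - a) < \<delta> \<Longrightarrow> (\<Sum>(a, b)\<in>D. \<bar>f b - f a\<bar>) < \<epsilon> / 2"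
      using abs_continuous_onD[OF ac, of "\<epsilon>/2"] by auto
    have "(\<Sum>(a, b)\<in>E. \<bar>V b - V a\<bar>) < \<epsilon>" if E: "interval_family {0..1} E" and len: "(\<Sum>(a, b)\<in>E. b - a) < \<delta>" for E
    proof -
      have finE: "finite E" using E by (simp add: interval_family_def)
      have E': "0 \<le> fst i" "fst i < snd i" "snd i \<le> 1" if "i \<in> E" for i
        using E that by (auto simp: interval_family_def)
      \<comment> \<open>The error allowed per interval of \<open>E\<close>: the total is at most
        \<open>\<epsilon> / 2\<close>, and \<open>+ 1\<close> covers the empty family.\<close>
      define \<eta> where "\<eta> = \<epsilon> / 2 / (real (card E) + 1)"
      have \<eta>: "\<eta> > 0" using \<open>\<epsilon> > 0\<close> by (simp add: \<eta>_def)
      have "\<forall>i\<in>E. \<exists>D. interval_family {0..snd i} D \<and> V (snd i) - \<eta> < W D"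
      proof
        fix i assume "i \<in> E"
        show "\<exists>D. interval_family {0..snd i} D \<and> V (snd i) - \<eta> < W D"
        proof (rule ccontr)
          assume "\<not> ?thesis"
          then have "V (snd i) \<le> V (snd i) - \<eta>" by (intro least) force
          then show False using \<eta> by simp
        qed
      qed
      then obtain D where D: "\<And>i. i \<in> E \<Longrightarrow> interval_family {0..snd i} (D i)" "\<And>i. i \<in> E \<Longrightarrow> V (snd i) - \<eta> < W (D i)"
        by metis
      have finD: "finite (D i)" if "i \<in> E" for i using D(1)[OF that] by (simp add: interval_family_def)
      have D': "0 \<le> fst j" "fst j < snd j" "snd j \<le> snd i" if "i \<in> E" "j \<in> D i" for i j
        using D(1)[OF that(1)] that(2) by (auto simp: interval_family_def)
      have VW: "V (snd i) - V (fst i) \<le> (\<Sum>j\<in>D i. \<bar>f (max (snd j) (fst i)) - f (max (fst j) (fst i))\<bar>) + \<eta>" if i: "i \<in> E" for i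
      proof -
        let ?a = "fst i"
        obtain F where F: "interval_family {0..?a} F"
           "\<And>g :: real \<Rightarrow> real \<Rightarrow> real. (\<And>x. g x x = 0) \<Longrightarrow> (\<Sum>(a, b)\<in>F. g a b) = (\<Sum>j\<in>D i. g (min (fst j) ?a) (min (snd j) ?a))"
        proof (rule interval_family_image[OF finD[OF i], of "\<lambda>j. min (fst j) ?a" "{0..?a}" "\<lambda>j. min (snd j) ?a"])
          show "min (fst j) ?a \<in> {0..?a} \<and> min (snd j) ?a \<in> {0..?a} \<and> min (fst j) ?a \<le> min (snd j) ?a" if "j \<in> D i" for j
            using D'[OF i that] E'[OF i] by auto
          show "disjoint_family_on (\<lambda>j. {min (fst j) ?a<..<min (snd j) ?a}) (D i)"
            by (rule disjoint_family_on_shrink[OF interval_family_disjoint[OF D(1)[OF i]]]) auto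
        qed blast
        have "(\<Sum>j\<in>D i. \<bar>f (min (snd j) ?a) - f (min (fst j) ?a)\<bar>) = W F"
          unfolding W_def using F(2)[of "\<lambda>a b. \<bar>f b - f a\<bar>"] by simp
        also have "\<dots> \<le> V ?a" using upper[OF F(1)] E'[OF i] by simp
        finally have 1: "(\<Sum>j\<in>D i. \<bar>f (min (snd j) ?a) - f (min (fst j) ?a)\<bar>) \<le> V ?a" .
        have "W (D i) \<le> (\<Sum>j\<in>D i. \<bar>f (min (snd j) ?a) - f (min (fst j) ?a)\<bar> + \<bar>f (max (snd j) ?a) - f (max (fst j) ?a)\<bar>)"
          unfolding W_def case_prod_unfold
        proof (rule sum_mono)
          fix j assume j: "j \<in> D i"
          \<comment> \<open>An interval that straddles \<open>?a\<close> is cut there, with the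
            triangle inequality through \<open>f ?a\<close>; in the other cases one summand
            vanishes.\<close>
          consider "snd j \<le> ?a" | "?a \<le> fst j" | "fst j < ?a" "?a < snd j" by linarith
          then show "\<bar>f (snd j) - f (fst j)\<bar> \<le> \<bar>f (min (snd j) ?a) - f (min (fst j) ?a)\<bar> + \<bar>f (max (snd j) ?a) - f (max (fst j) ?a)\<bar>"
            using D'[OF i j] by cases simp_all
        qed
        then show ?thesis using 1 D(2)[OF i] by (simp add: sum.distrib)
      qed
      define I where "I = Sigma E D"
      have finI: "finite I" using finE finD by (simp add: I_def)
      define l :: "(real \<times> real) \<times> real \<times> real \<Rightarrow> real" where "l k = max (fst (snd k)) (fst (fst k))" for k
      define r :: "(real \<times> real) \<times> real \<times> real \<Rightarrow> real" where "r k = max (snd (snd k)) (fst (fst k))" for k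
      have lr: "l (i, j) = max (fst j) (fst i)" "r (i, j) = max (snd j) (fst i)" for i j
        by (simp_all add: l_def r_def)
      have lrI: "fst i \<le> l (i, j)" "l (i, j) \<le> r (i, j)" "r (i, j) \<le> snd i" if "i \<in> E" "j \<in> D i" for i j
        using D'[OF that] E'[OF that(1)] by (auto simp: lr)
      have disjE: "{l (i, j)<..<r (i, j)} \<inter> {l (i', j')<..<r (i', j')} = {}"
        if "i \<in> E" "j \<in> D i" "i' \<in> E" "j' \<in> D i'" "(i, j) \<noteq> (i', j')" for i j i' j'
      proof (cases "i = i'")
        case False
        then have "{fst i<..<snd i} \<inter> {fst i'<..<snd i'} = {}"
          using interval_family_disjoint[OF E] that unfolding disjoint_family_on_def by blast
        moreover have "{l (i, j)<..<r (i, j)} \<subseteq> {fst i<..<snd i}" "{l (i', j')<..<r (i', j')} \<subseteq> {fst i'<..<snd i'}"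
          using lrI[OF that(1,2)] lrI[OF that(3,4)] by auto
        ultimately show ?thesis by blast
      next
        case True
        then have "{fst j<..<snd j} \<inter> {fst j'<..<snd j'} = {}"
          using interval_family_disjoint[OF D(1)[OF that(1)]] that unfolding disjoint_family_on_def by blast
        moreover have "{l (i, j)<..<r (i, j)} \<subseteq> {fst j<..<snd j}" "{l (i', j')<..<r (i', j')} \<subseteq> {fst j'<..<snd j'}"
          unfolding lr by auto
        ultimately show ?thesis by blast
      qed
      obtain F where F: "interval_family {0..1} F"
           "\<And>g :: real \<Rightarrow> real \<Rightarrow> real. (\<And>x. g x x = 0) \<Longrightarrow> (\<Sum>(a, b)\<in>F. g a b) = (\<Sum>k\<in>I. g (l k) (r k))"
      proof (rule interval_family_image[OF finI, of l "{0..1}" r])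
        show "l k \<in> {0..1} \<and> r k \<in> {0..1} \<and> l k \<le> r k" if "k \<in> I" for k
        proof -
          obtain i j where k: "k = (i, j)" "i \<in> E" "j \<in> D i" using \<open>k \<in> I\<close> unfolding I_def by (elim SigmaE)
          then show ?thesis using lrI[OF k(2,3)] E'[OF k(2)] by simp
        qed
        show "disjoint_family_on (\<lambda>k. {l k<..<r k}) I"
          unfolding disjoint_family_on_def using disjE by (auto simp: I_def)
      qed blast
      have "(\<Sum>(a, b)\<in>F. b - a) = (\<Sum>i\<in>E. \<Sum>j\<in>D i. r (i, j) - l (i, j))"
        using F(2)[of "\<lambda>a b. b - a"] finE finD by (simp add: I_def sum.Sigma case_prod_unfold)
      also have "\<dots> \<le> (\<Sum>i\<in>E. snd i - fst i)"
      proof (rule sum_mono)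
        fix i assume i: "i \<in> E"
        obtain G where G: "interval_family {fst i..snd i} G"
           "\<And>g :: real \<Rightarrow> real \<Rightarrow> real. (\<And>x. g x x = 0) \<Longrightarrow> (\<Sum>(a, b)\<in>G. g a b) = (\<Sum>j\<in>D i. g (l (i, j)) (r (i, j)))"
        proof (rule interval_family_image[OF finD[OF i], of "\<lambda>j. l (i, j)" "{fst i..snd i}" "\<lambda>j. r (i, j)"])
          show "l (i, j) \<in> {fst i..snd i} \<and> r (i, j) \<in> {fst i..snd i} \<and> l (i, j) \<le> r (i, j)" if "j \<in> D i" for j
            using lrI[OF i that] by auto
          show "disjoint_family_on (\<lambda>j. {l (i, j)<..<r (i, j)}) (D i)"
            unfolding disjoint_family_on_def using disjE[OF i _ i] by simp
        qed blast
        show "(\<Sum>j\<in>D i. r (i, j) - l (i, j)) \<le> snd i - fst i"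
          using interval_family_length[OF G(1)] G(2)[of "\<lambda>a b. b - a"] E'(2)[OF i] by simp
      qed
      also have "\<dots> < \<delta>" using len by (simp add: case_prod_unfold)
      finally have "(\<Sum>(a, b)\<in>F. \<bar>f b - f a\<bar>) < \<epsilon> / 2" using \<delta>(2) F(1) by blast
      also have "(\<Sum>(a, b)\<in>F. \<bar>f b - f a\<bar>) = (\<Sum>i\<in>E. \<Sum>j\<in>D i. \<bar>f (r (i, j)) - f (l (i, j))\<bar>)"
        using F(2)[of "\<lambda>a b. \<bar>f b - f a\<bar>"] finE finD by (simp add: I_def sum.Sigma case_prod_unfold)
      finally have half: "(\<Sum>i\<in>E. \<Sum>j\<in>D i. \<bar>f (r (i, j)) - f (l (i, j))\<bar>) < \<epsilon> / 2" .
      have "(\<Sum>(a, b)\<in>E. \<bar>V b - V a\<bar>) = (\<Sum>i\<in>E. V (snd i) - V (fst i))"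
        unfolding case_prod_unfold
      proof (rule sum.cong)
        fix i assume "i \<in> E"
        then show "\<bar>V (snd i) - V (fst i)\<bar> = V (snd i) - V (fst i)" using V[of "fst i" "snd i"] E'[of i] by simp
      qed simp
      also have "\<dots> \<le> (\<Sum>i\<in>E. (\<Sum>j\<in>D i. \<bar>f (r (i, j)) - f (l (i, j))\<bar>) + \<eta>)"
        using VW by (intro sum_mono) (simp add: lr)
      also have "\<dots> < \<epsilon> / 2 + real (card E) * \<eta>"
        using half by (simp add: sum.distrib)
      also have "real (card E) * \<eta> \<le> \<epsilon> / 2"
        using \<open>\<epsilon> > 0\<close> by (simp add: \<eta>_def field_simps)
      finally show ?thesis by simp
    qed
    then show "\<exists>\<delta>>0. \<forall>D. finite D \<and> (\<forall>(a, b)\<in>D. a \<in> {0..1} \<and> b \<in> {0..1} \<and> a < b) \<and>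
       disjoint_family_on (\<lambda>(a, b). {a<..<b}) D \<and> (\<Sum>(a, b)\<in>D. b - a) < \<delta> \<longrightarrow> (\<Sum>(a, b)\<in>D. \<bar>V b - V a\<bar>) < \<epsilon>"
      using \<open>\<delta> > 0\<close> unfolding interval_family_def by auto
  qed
  with V show thesis using that by blast
qed

lemma abs_continuous_on_imp_continuous_on:
  assumes "abs_continuous_on S f"
  shows "continuous_on S f"
  unfolding continuous_on_iff
proof (intro ballI allI impI)
  fix x e :: real assume x: "x \<in> S" "e > 0"
  obtain d where d: "d > 0" "\<And>D. interval_family S D \<Longrightarrow> (\<Sum>(a, b)\<in>D. b - a) < d \<Longrightarrow> (\<Sum>(a, b)\<in>D. \<bar>f b - f a\<bar>) < e"
    using abs_continuous_onD[OF assms x(2)] by blast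
  have one: "interval_family S {(a, b)}" if "a \<in> S" "b \<in> S" "a < b" for a b
    using that by (simp add: interval_family_def disjoint_family_on_def)
  have "dist (f y) (f x) < e" if y: "y \<in> S" "dist y x < d" for y
  proof (cases y x rule: linorder_cases)
    case less
    then show ?thesis using d(2)[OF one[OF y(1) x(1)]] y by (simp add: dist_real_def abs_minus_commute)
  next
    case greater
    then show ?thesis using d(2)[OF one[OF x(1) y(1)]] y by (simp add: dist_real_def)
  qed (use x in simp)
  then show "\<exists>d>0. \<forall>x'\<in>S. dist x' x < d \<longrightarrow> dist (f x') (f x) < e" using d(1) by blast
qed

lemma abs_continuous_on_add:
  assumes f: "abs_continuous_on S f" and g: "abs_continuous_on S g"
  shows "abs_continuous_on S (\<lambda>x. f x + g x)"
  unfolding abs_continuous_on_def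
proof (intro allI impI)
  fix e :: real assume "e > 0"
  then have e: "e / 2 > 0" by simp
  obtain d1 where d1: "d1 > 0" "\<And>D. interval_family S D \<Longrightarrow> (\<Sum>(a, b)\<in>D. b - a) < d1 \<Longrightarrow> (\<Sum>(a, b)\<in>D. \<bar>f b - f a\<bar>) < e/2"
    using abs_continuous_onD[OF f e] by blast
  obtain d2 where d2: "d2 > 0" "\<And>D. interval_family S D \<Longrightarrow> (\<Sum>(a, b)\<in>D. b - a) < d2 \<Longrightarrow> (\<Sum>(a, b)\<in>D. \<bar>g b - g a\<bar>) < e/2"
    using abs_continuous_onD[OF g e] by blast
  have "(\<Sum>(a, b)\<in>D. \<bar>f b + g b - (f a + g a)\<bar>) < e"
    if D: "interval_family S D" "(\<Sum>(a, b)\<in>D. b - a) < min d1 d2" for D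
  proof -
    have "(\<Sum>(a, b)\<in>D. \<bar>f b + g b - (f a + g a)\<bar>) \<le> (\<Sum>(a, b)\<in>D. \<bar>f b - f a\<bar> + \<bar>g b - g a\<bar>)"
      by (rule sum_mono) auto
    also have "\<dots> = (\<Sum>(a, b)\<in>D. \<bar>f b - f a\<bar>) + (\<Sum>(a, b)\<in>D. \<bar>g b - g a\<bar>)"
      by (simp add: case_prod_unfold sum.distrib)
    also have "\<dots> < e" using d1(2)[of D] d2(2)[of D] D by simp
    finally show ?thesis .
  qed
  then show "\<exists>\<delta>>0. \<forall>D. finite D \<and> (\<forall>(a, b)\<in>D. a \<in> S \<and> b \<in> S \<and> a < b) \<and>
       disjoint_family_on (\<lambda>(a, b). {a<..<b}) D \<and> (\<Sum>(a, b)\<in>D. b - a) < \<delta> \<longrightarrow> (\<Sum>(a, b)\<in>D. \<bar>f b + g b - (f a + g a)\<bar>) < e"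
    using d1(1) d2(1) unfolding interval_family_def by (intro exI[of _ "min d1 d2"]) auto
qed

lemma abs_continuous_on_uminus:
  "abs_continuous_on S f \<Longrightarrow> abs_continuous_on S (\<lambda>x. - f x)"
proof -
  have "\<bar>- f b - - f a\<bar> = \<bar>f b - f a\<bar>" for a b by simp
  then show "abs_continuous_on S f \<Longrightarrow> abs_continuous_on S (\<lambda>x. - f x)"
    unfolding abs_continuous_on_def by simp
qed

section \<open>Density of an absolutely continuous function\<close>

text \<open>\<open>v\<close> comes from the Radon-Nikodym derivative of the Stieltjes measure of
  \<open>G\<close>. Absolute continuity of the function gives that of the measure: a null set is
  covered by nonoverlapping intervals of small total length, and the measure of finitely many of
  them is a sum of increments of \<open>G\<close>.\<close>

lemma mono_abs_continuous_density:
  fixes G :: "real \<Rightarrow> real"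
  assumes ac: "abs_continuous_on {0..1} G" and mono: "\<And>s t. 0 \<le> s \<Longrightarrow> s \<le> t \<Longrightarrow> t \<le> 1 \<Longrightarrow> G s \<le> G t"
  obtains v where "integrable lborel v" "\<And>x. 0 \<le> v x" "\<And>x. x \<notin> {0<..1} \<Longrightarrow> v x = 0"
    "\<And>t. t \<in> {0..1} \<Longrightarrow> G t - G 0 = (LINT s:{..t}|lborel. v s)"
proof -
  \<comment> \<open>Clamping extends \<open>G\<close> by constants to a continuous nondecreasing
    function on the line, and it does not lengthen intervals.\<close>
  define cl :: "real \<Rightarrow> real" where "cl x = max 0 (min x 1)" for x
  define H where "H x = G (cl x)" for x
  have cl: "cl x \<in> {0..1}" "x \<le> y \<Longrightarrow> cl x \<le> cl y" "x \<le> y \<Longrightarrow> cl y - cl x \<le> y - x" for x y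
    by (auto simp: cl_def)
  have Hmono: "H x \<le> H y" if "x \<le> y" for x y
    unfolding H_def using cl(1)[of x] cl(1)[of y] cl(2)[OF that] by (intro mono) auto
  have "continuous_on UNIV H"
    unfolding H_def by (rule continuous_on_compose2[OF abs_continuous_on_imp_continuous_on[OF ac]])
      (auto simp: cl_def intro!: continuous_intros)
  then have Hcont: "continuous (at x) H" for x by (simp add: continuous_on_eq_continuous_at)
  then have Hright: "continuous (at_right x) H" for x
    by (rule continuous_at_imp_continuous_within)
  define \<mu> where "\<mu> = interval_measure H"
  have \<mu>sets: "sets \<mu> = sets borel" by (simp add: \<mu>_def)
  have \<mu>Ioc: "emeasure \<mu> {a<..b} = ennreal (H b - H a)" if "a \<le> b" for a b
    unfolding \<mu>_def using that Hmono Hright by (intro emeasure_interval_measure_Ioc) auto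
  \<comment> \<open>Points carry no mass because \<open>H\<close> is continuous, so the closed
    intervals of the cover also have the increment of \<open>H\<close> as their measure.\<close>
  have \<mu>Icc: "emeasure \<mu> {a..b} = ennreal (H b - H a)" if "a \<le> b" for a b
    unfolding \<mu>_def using that Hmono \<open>continuous_on UNIV H\<close> by (intro emeasure_interval_measure_Icc) auto
  have ac\<mu>: "absolutely_continuous lborel \<mu>"
    unfolding absolutely_continuous_def
  proof
    fix N :: "real set" assume N: "N \<in> null_sets lborel"
    \<comment> \<open>Restricted to a bounded interval because the covering lemma works inside a
      box; these intersections exhaust \<open>N\<close>.\<close>
    have small: "emeasure \<mu> (N \<inter> {-real (Suc n)..real (Suc n)}) \<le> ennreal \<epsilon>" if \<epsilon>: "\<epsilon> > 0" for n and \<epsilon> :: real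
    proof -
      let ?n = "real (Suc n)"
      let ?N = "N \<inter> {-?n..?n}"
      obtain \<delta> where \<delta>: "\<delta> > 0" "\<And>D. interval_family {0..1} D \<Longrightarrow> (\<Sum>(a, b)\<in>D. b - a) < \<delta> \<Longrightarrow> (\<Sum>(a, b)\<in>D. \<bar>G b - G a\<bar>) < \<epsilon>"
        using abs_continuous_onD[OF ac \<epsilon>] by blast
      have "?N \<in> null_sets lborel" using N by (auto intro: null_set_Int2)
      then have nullN: "?N \<in> null_sets lebesgue" by (rule null_sets_completionI)
      then have "?N \<in> lmeasurable" "measure lebesgue ?N = 0"
        using negligible_iff_null_sets negligible_imp_measurable negligible_imp_measure0 by blast+
      \<comment> \<open>The choice \<open>\<delta> / 2\<close> turns the non-strict bound of the
        covering lemma into the strict one that absolute continuity asks for.\<close>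
      then obtain \<D> where \<D>: "countable \<D>"
        "\<And>K. K \<in> \<D> \<Longrightarrow> K \<subseteq> cbox (-?n) ?n \<and> K \<noteq> {} \<and> (\<exists>c d. K = cbox c d)"
        "pairwise (\<lambda>A B. interior A \<inter> interior B = {}) \<D>"
        "\<And>K. \<lbrakk>K \<in> \<D>; box (-?n) ?n \<noteq> {}\<rbrakk> \<Longrightarrow> interior K \<noteq> {}"
        "?N \<subseteq> \<Union>\<D>" "\<Union>\<D> \<in> lmeasurable" "measure lebesgue (\<Union>\<D>) \<le> 0 + \<delta> / 2"
        using measurable_outer_intervals_bounded[of ?N "-?n" ?n "\<delta>/2"] \<delta>(1) by (smt (verit) Int_lower2 cbox_interval half_gt_zero)
      have K: "K = {Inf K..Sup K}" "Inf K < Sup K" if "K \<in> \<D>" for K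
      proof -
        obtain c d where "K = cbox c d" using \<D>(2)[OF \<open>K \<in> \<D>\<close>] by blast
        then have cd: "K = {c..d}" by simp
        have "box (-?n) ?n \<noteq> {}" by simp
        then have "c < d" using \<D>(4)[OF \<open>K \<in> \<D>\<close>] unfolding cd by auto
        then show "K = {Inf K..Sup K}" "Inf K < Sup K" by (auto simp: cd)
      qed
      have fin: "measure \<mu> (\<Union>D') \<le> \<epsilon>" if D': "D' \<subseteq> \<D>" "finite D'" for D'
      proof -
        have dj: "disjoint_family_on (\<lambda>K. {Inf K<..<Sup K}) D'"
          unfolding disjoint_family_on_def
        proof (intro ballI impI)
          fix A B assume AB: "A \<in> D'" "B \<in> D'" "A \<noteq> B"
          then have "interior A \<inter> interior B = {}" using \<D>(3) D'(1) by (meson pairwiseD subsetD)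
          moreover have "interior A = {Inf A<..<Sup A}" "interior B = {Inf B<..<Sup B}"
            using K(1)[of A] K(1)[of B] AB D'(1) by (metis interior_atLeastAtMost_real subsetD)+
          ultimately show "{Inf A<..<Sup A} \<inter> {Inf B<..<Sup B} = {}" by simp
        qed
        obtain F where F: "interval_family {0..1} F"
           "\<And>g :: real \<Rightarrow> real \<Rightarrow> real. (\<And>x. g x x = 0) \<Longrightarrow> (\<Sum>(a, b)\<in>F. g a b) = (\<Sum>K\<in>D'. g (cl (Inf K)) (cl (Sup K)))"
        proof (rule interval_family_image[OF D'(2), of "\<lambda>K. cl (Inf K)" "{0..1}" "\<lambda>K. cl (Sup K)"])
          show "cl (Inf K) \<in> {0..1} \<and> cl (Sup K) \<in> {0..1} \<and> cl (Inf K) \<le> cl (Sup K)" if "K \<in> D'" for K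
            using K(2)[of K] D' that cl(1) cl(2)[of "Inf K" "Sup K"] by auto
          show "disjoint_family_on (\<lambda>K. {cl (Inf K)<..<cl (Sup K)}) D'"
            by (rule disjoint_family_on_shrink[OF dj]) (auto simp: cl_def)
        qed blast
        have "(\<Sum>(a, b)\<in>F. b - a) = (\<Sum>K\<in>D'. cl (Sup K) - cl (Inf K))"
          using F(2)[of "\<lambda>a b. b - a"] by simp
        also have "\<dots> \<le> (\<Sum>K\<in>D'. measure lborel {Inf K<..<Sup K})"
          using K(2) D'(1) cl(3) by (intro sum_mono) (auto simp: less_imp_le)
        also have "\<dots> = measure lborel (\<Union>K\<in>D'. {Inf K<..<Sup K})"
        proof (rule measure_finite_Union[symmetric, OF D'(2) _ dj])
          show "emeasure lborel {Inf K<..<Sup K} \<noteq> \<infinity>" if "K \<in> D'" for K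
            using K(2)[of K] D'(1) that by (auto simp: emeasure_lborel_Ioo)
        qed auto
        also have "\<dots> = measure lebesgue (\<Union>K\<in>D'. {Inf K<..<Sup K})"
          by (intro measure_completion[symmetric]) (simp add: borel_open open_UN)
        also have "\<dots> \<le> measure lebesgue (\<Union>\<D>)"
        proof (rule measure_mono_fmeasurable[OF _ _ \<D>(6)])
          show "(\<Union>K\<in>D'. {Inf K<..<Sup K}) \<subseteq> \<Union>\<D>"
          proof
            fix x assume "x \<in> (\<Union>K\<in>D'. {Inf K<..<Sup K})"
            then obtain A where "A \<in> D'" "x \<in> {Inf A..Sup A}" by auto
            then show "x \<in> \<Union>\<D>" using K(1)[of A] D'(1) by blast
          qed
          show "(\<Union>K\<in>D'. {Inf K<..<Sup K}) \<in> sets lebesgue"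
            by (intro sets_completionI_sets) (simp add: borel_open open_UN)
        qed
        also have "\<dots> < \<delta>" using \<D>(7) \<delta>(1) by simp
        finally have "(\<Sum>(a, b)\<in>F. \<bar>G b - G a\<bar>) < \<epsilon>" using \<delta>(2)[OF F(1)] by blast
        also have "(\<Sum>(a, b)\<in>F. \<bar>G b - G a\<bar>) = (\<Sum>K\<in>D'. \<bar>H (Sup K) - H (Inf K)\<bar>)"
          using F(2)[of "\<lambda>a b. \<bar>G b - G a\<bar>"] by (simp add: H_def)
        also have "\<dots> = (\<Sum>K\<in>D'. measure \<mu> K)"
        proof (rule sum.cong)
          fix K' assume K': "K' \<in> D'"
          with D' K[of K'] have *: "K' = {Inf K'..Sup K'}" "Inf K' \<le> Sup K'" by auto
          have "measure \<mu> {Inf K'..Sup K'} = H (Sup K') - H (Inf K')"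
            using \<mu>Icc[OF *(2)] Hmono[OF *(2)] by (simp add: measure_def)
          then show "\<bar>H (Sup K') - H (Inf K')\<bar> = measure \<mu> K'" using * Hmono[OF *(2)] by simp
        qed simp
        finally have "(\<Sum>K\<in>D'. measure \<mu> K) < \<epsilon>" .
        moreover have "measure \<mu> (\<Union>D') \<le> (\<Sum>K\<in>D'. measure \<mu> K)"
        proof (rule measure_Union_le[OF D'(2)])
          fix A assume "A \<in> D'"
          then have "A = {Inf A..Sup A}" using K(1) D' by auto
          then show "A \<in> sets \<mu>" unfolding \<mu>sets by (metis atLeastAtMost_borel)
        qed
        ultimately show ?thesis by simp
      qed
      have fm: "K \<in> fmeasurable \<mu>" if "K \<in> \<D>" for K
      proof -
        have "{Inf K..Sup K} \<in> fmeasurable \<mu>"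
          by (rule fmeasurableI) (use \<mu>Icc K(2)[OF that] in \<open>auto simp: \<mu>sets\<close>)
        then show ?thesis using K(1)[OF that] by simp
      qed
      have U: "\<Union>\<D> \<in> fmeasurable \<mu>" "measure \<mu> (\<Union>\<D>) \<le> \<epsilon>"
        using fmeasurable_Union_bound[OF \<D>(1) fm fin] measure_Union_bound[OF \<D>(1) fm fin] by auto
      have "emeasure \<mu> ?N \<le> emeasure \<mu> (\<Union>\<D>)"
        using U(1) \<D>(5) by (intro emeasure_mono) auto
      also have "\<dots> \<le> ennreal \<epsilon>" using U by (simp add: emeasure_eq_measure2 ennreal_leI)
      finally show ?thesis .
    qed
    have "emeasure \<mu> (N \<inter> {-real (Suc n)..real (Suc n)}) \<le> 0" for n
    proof (rule ennreal_le_epsilon)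
      fix e :: real assume "0 < e"
      then show "emeasure \<mu> (N \<inter> {-real (Suc n)..real (Suc n)}) \<le> 0 + ennreal e"
        unfolding add_0 by (rule small)
    qed
    moreover have "N \<inter> {-real (Suc n)..real (Suc n)} \<in> sets \<mu>" for n
      using N unfolding \<mu>sets null_sets_def by auto
    ultimately have "N \<inter> {-real (Suc n)..real (Suc n)} \<in> null_sets \<mu>" for n
      unfolding null_sets_def le_zero_eq by blast
    then have "(\<Union>n. N \<inter> {-real (Suc n)..real (Suc n)}) \<in> null_sets \<mu>" by (intro null_sets_UN) auto
    moreover have "N = (\<Union>n. N \<inter> {-real (Suc n)..real (Suc n)})"
    proof -
      have "\<exists>n. x \<in> {-real (Suc n)..real (Suc n)}" for x
      proof -
        obtain n where "\<bar>x\<bar> \<le> real n" using real_arch_simple by blast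
        then show ?thesis by (intro exI[of _ n]) auto
      qed
      then show ?thesis by blast
    qed
    ultimately show "N \<in> null_sets \<mu>" by simp
  qed
  obtain g where g: "g \<in> borel_measurable lborel" "density lborel g = \<mu>"
    using sigma_finite_measure.Radon_Nikodym[OF sigma_finite_lborel ac\<mu>] \<mu>sets by auto
  have gm[measurable]: "g \<in> borel_measurable borel" using g(1) by simp
  have gI: "(\<integral>\<^sup>+x\<in>{0<..t}. g x \<partial>lborel) = ennreal (G t - G 0)" if "t \<in> {0..1}" for t
  proof -
    have "(\<integral>\<^sup>+x\<in>{0<..t}. g x \<partial>lborel) = emeasure \<mu> {0<..t}"
      using that unfolding g(2)[symmetric] by (subst emeasure_density) auto
    also have "\<dots> = ennreal (G t - G 0)" using that \<mu>Ioc[of 0 t] by (simp add: H_def cl_def)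
    finally show ?thesis .
  qed
  \<comment> \<open>The Radon-Nikodym derivative has values in \<open>ennreal\<close>; its mass on
    \<open>{0<..1}\<close> is finite, so there \<open>enn2real\<close> changes it only on a null
    set.\<close>
  have "AE x in lborel. g x * indicator {0<..1} x \<noteq> \<infinity>"
    by (rule nn_integral_PInf_AE) (use gI[of 1] in auto)
  then have gfin: "AE x in lborel. ennreal (enn2real (g x) * indicator {0<..1} x) = g x * indicator {0<..1} x"
    by eventually_elim (auto simp: indicator_def less_top)
  define v where "v x = enn2real (g x) * indicator {0<..1} x" for x
  have [measurable]: "v \<in> borel_measurable borel" unfolding v_def by measurable
  have v0: "0 \<le> v x" for x by (simp add: v_def)
  have gv: "(\<integral>\<^sup>+x. ennreal (v x * indicator {..t} x) \<partial>lborel) = ennreal (G t - G 0)" if "t \<in> {0..1}" for t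
  proof -
    have "(\<integral>\<^sup>+x. ennreal (v x * indicator {..t} x) \<partial>lborel) = (\<integral>\<^sup>+x\<in>{0<..t}. g x \<partial>lborel)"
      using gfin by (intro nn_integral_cong_AE, eventually_elim) (use that in \<open>auto simp: v_def indicator_def\<close>)
    then show ?thesis using gI[OF that] by simp
  qed
  have "(\<integral>\<^sup>+x. ennreal (v x) \<partial>lborel) = (\<integral>\<^sup>+x. ennreal (v x * indicator {..1} x) \<partial>lborel)"
    by (intro nn_integral_cong) (auto simp: v_def indicator_def)
  then have "integrable lborel v"
    using gv[of 1] v0 by (intro integrableI_nonneg) auto
  moreover have "G t - G 0 = (LINT s:{..t}|lborel. v s)" if "t \<in> {0..1}" for t
  proof -
    have "(LINT s:{..t}|lborel. v s) = (\<integral>x. v x * indicator {..t} x \<partial>lborel)"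
      by (simp add: set_lebesgue_integral_def mult.commute)
    also have "\<dots> = enn2real (\<integral>\<^sup>+x. ennreal (v x * indicator {..t} x) \<partial>lborel)"
      using v0 by (intro integral_eq_nn_integral) auto
    also have "\<dots> = G t - G 0" using gv[OF that] mono[of 0 t] that by simp
    finally show ?thesis by simp
  qed
  moreover have "v x = 0" if "x \<notin> {0<..1}" for x using that by (auto simp: v_def indicator_def)
  ultimately show thesis using that v0 by blast
qed

text \<open>Jordan decomposition \<open>f = V - (V - f)\<close>: since the increments of
  \<open>V\<close> dominate those of \<open>f\<close>, both parts are nondecreasing.\<close>

theorem abs_continuous_on_density:
  assumes ac: "abs_continuous_on {0..1} f"
  obtains v where "integrable lborel v" "\<And>x. x \<notin> {0<..1} \<Longrightarrow> v x = 0"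
    "\<And>t. t \<in> {0..1} \<Longrightarrow> f t - f 0 = (LINT s:{..t}|lborel. v s)"
proof -
  obtain V where V: "abs_continuous_on {0..1} V"
    "\<And>s t. 0 \<le> s \<Longrightarrow> s \<le> t \<Longrightarrow> t \<le> 1 \<Longrightarrow> \<bar>f t - f s\<bar> \<le> V t - V s"
    using abs_continuous_on_variation[OF ac] by blast
  have "V s \<le> V t" "V s + - f s \<le> V t + - f t" if "0 \<le> s" "s \<le> t" "t \<le> 1" for s t
    using V(2)[OF that] by auto
  then obtain v w where v: "integrable lborel v" "\<And>x. x \<notin> {0<..1} \<Longrightarrow> v x = 0"
      "\<And>t. t \<in> {0..1} \<Longrightarrow> V t - V 0 = (LINT s:{..t}|lborel. v s)"
    and w: "integrable lborel w" "\<And>x. x \<notin> {0<..1} \<Longrightarrow> w x = 0"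
      "\<And>t. t \<in> {0..1} \<Longrightarrow> (V t + - f t) - (V 0 + - f 0) = (LINT s:{..t}|lborel. w s)"
    using mono_abs_continuous_density[OF V(1)]
      mono_abs_continuous_density[OF abs_continuous_on_add[OF V(1) abs_continuous_on_uminus[OF ac]]] by metis
  have si: "set_integrable lborel {..t} h" if "integrable lborel h" for t and h :: "real \<Rightarrow> real"
    unfolding set_integrable_def using that by (intro integrable_mult_indicator) auto
  show thesis
  proof
    show "integrable lborel (\<lambda>x. v x - w x)" using v(1) w(1) by simp
    show "v x - w x = 0" if "x \<notin> {0<..1}" for x using v(2) w(2) that by simp
    show "f t - f 0 = (LINT s:{..t}|lborel. v s - w s)" if "t \<in> {0..1}" for t
      using v(3)[OF that] w(3)[OF that] set_integral_diff(2)[OF si[OF v(1)] si[OF w(1)], of t] by simp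
  qed
qed

section \<open>Change of time\<close>

text \<open>\<open>\<psi>\<close> is the inverse of a primitive of \<open>w\<close>.\<close>

definition is_time_change :: "(real \<Rightarrow> real) \<Rightarrow> (real \<Rightarrow> real) \<Rightarrow> bool" where
  "is_time_change w \<psi> \<longleftrightarrow>
     \<psi> 0 = 0 \<and> strict_mono \<psi> \<and>
     (\<forall>s t. s \<le> t \<longrightarrow> t - s = \<psi> t - \<psi> s + (LINT r:{\<psi> s<..\<psi> t}|lborel. w r - 1)) \<and>
     (\<forall>f. f \<in> borel_measurable borel \<longrightarrow> (\<integral>\<^sup>+t. f (\<psi> t) \<partial>lborel) = (\<integral>\<^sup>+s. f s * ennreal (w s) \<partial>lborel)) \<and>
     (AE t in lborel. (\<psi> has_real_derivative inverse (w (\<psi> t))) (at t))"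

text \<open>The preimage under \<open>\<psi>\<close> of a null set has as its measure the integral
  of \<open>w\<close> over that set, which is 0. Hence derivatives known at almost every
  \<open>s\<close> can be used at \<open>s = \<psi> t\<close> for almost every
  \<open>t\<close>.\<close>

lemma AE_time_change:
  fixes \<psi> w :: "real \<Rightarrow> real"
  assumes nn: "\<And>f. f \<in> borel_measurable borel \<Longrightarrow> (\<integral>\<^sup>+t. f (\<psi> t) \<partial>lborel) = (\<integral>\<^sup>+s. f s * ennreal (w s) \<partial>lborel)"
    and [measurable]: "\<psi> \<in> borel_measurable borel" and P: "AE s in lborel. P s"
  shows "AE t in lborel. P (\<psi> t)"
proof -
  obtain N where N: "{s \<in> space lborel. \<not> P s} \<subseteq> N" "emeasure lborel N = 0" "N \<in> sets lborel"
    using AE_E[OF P] by blast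
  have [measurable]: "N \<in> sets borel" using N(3) by simp
  have "AE s in lborel. s \<notin> N" using N by (intro AE_not_in) auto
  then have "AE s in lborel. indicator N s * ennreal (w s) = 0"
    by eventually_elim auto
  then have "(\<integral>\<^sup>+s. indicator N s * ennreal (w s) \<partial>lborel) = (\<integral>\<^sup>+s. 0 \<partial>(lborel :: real measure))"
    by (rule nn_integral_cong_AE)
  then have "(\<integral>\<^sup>+t. indicator N (\<psi> t) \<partial>lborel) = 0"
    using nn[of "indicator N"] by simp
  then have "AE t in lborel. (indicator N (\<psi> t) :: ennreal) = 0"
    by (subst (asm) nn_integral_0_iff_AE) auto
  then show ?thesis
    by eventually_elim (use N(1) in \<open>auto simp: indicator_def split: if_splits\<close>)
qed

text \<open>\<open>\<tau>\<close> is the identity plus a bounded nondecreasing continuous function.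
  It therefore expands distances, which makes it injective with a 1-Lipschitz inverse, and it is
  onto. The integral formula says that \<open>\<tau>\<close> carries the measure with density
  \<open>w\<close> to Lebesgue measure.\<close>

lemma time_change_exists:
  fixes w :: "real \<Rightarrow> real"
  assumes [measurable]: "w \<in> borel_measurable borel" and w1: "\<And>s. 1 \<le> w s"
    and int: "integrable lborel (\<lambda>s. w s - 1)" and supp: "\<And>s. s \<notin> {0<..1} \<Longrightarrow> w s = 1"
  shows "\<exists>\<psi>. is_time_change w \<psi>"
proof -
  define F where "F t = (LINT r:{..t}|lborel. w r - 1)" for t
  define \<tau> where "\<tau> s = s + F s" for s
  define \<eta> where "\<eta> = (LINT r|lborel. w r - 1)"
  have si: "set_integrable lborel A (\<lambda>s. w s - 1)" if "A \<in> sets borel" for A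
    unfolding set_integrable_def using int that by (intro integrable_mult_indicator) auto
  have Fdiff: "F t - F s = (LINT r:{s<..t}|lborel. w r - 1)" if "s \<le> t" for s t
    unfolding F_def using has_integral_indefinite_diff(2)[OF int that] .
  have nonneg: "0 \<le> (LINT r:A|lborel. w r - 1)" for A
    unfolding set_lebesgue_integral_def using w1 by (intro integral_nonneg_AE) (auto simp: indicator_def)
  have \<tau>diff: "\<tau> t - \<tau> s = t - s + (LINT r:{s<..t}|lborel. w r - 1)" if "s \<le> t" for s t
    using Fdiff[OF that] by (simp add: \<tau>_def)
  have \<tau>ge: "\<tau> t - \<tau> s \<ge> t - s" if "s \<le> t" for s t
    using \<tau>diff[OF that] nonneg[of "{s<..t}"] by simp
  have F\<eta>: "0 \<le> F t" "F t \<le> \<eta>" for t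
  proof -
    show "0 \<le> F t" unfolding F_def by (rule nonneg)
    show "F t \<le> \<eta>" unfolding F_def \<eta>_def set_lebesgue_integral_def
      using w1 int by (intro integral_mono integrable_mult_indicator) (auto simp: indicator_def)
  qed
  have "F 0 = 0"
  proof -
    have "F 0 = (LINT r|(lborel :: real measure). (0::real))"
      unfolding F_def set_lebesgue_integral_def by (intro Bochner_Integration.integral_cong) (use supp in \<open>auto simp: indicator_def\<close>)
    then show ?thesis by simp
  qed
  then have \<tau>0: "\<tau> 0 = 0" by (simp add: \<tau>_def)
  have cont: "continuous_on {a..b} \<tau>" for a b
    unfolding \<tau>_def F_def by (intro continuous_intros continuous_on_subset[OF continuous_on_indefinite[OF int]]) auto
  have "\<exists>s. \<tau> s = t" for t
  proof -
    \<comment> \<open>From \<open>0 \<le> F\<close> and \<open>F \<le> \<eta>\<close> one gets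
      \<open>\<tau> (t - \<eta>) \<le> t\<close> and \<open>t \<le> \<tau> t\<close>.\<close>
    have "\<exists>s\<ge>t - \<eta>. s \<le> t \<and> \<tau> s = t"
      using F\<eta>[of t] F\<eta>[of "t - \<eta>"] by (intro IVT' cont) (auto simp: \<tau>_def)
    then show ?thesis by blast
  qed
  then obtain \<psi> where \<tau>\<psi>: "\<And>t. \<tau> (\<psi> t) = t" by metis
  have \<tau>strict: "\<tau> s < \<tau> t" if "s < t" for s t using \<tau>ge[of s t] that by simp
  have \<tau>iff: "\<tau> s < \<tau> t \<longleftrightarrow> s < t" for s t using \<tau>strict[of s t] \<tau>strict[of t s] by (cases s t rule: linorder_cases) auto
  have \<psi>\<tau>: "\<psi> (\<tau> s) = s" for s
    using \<tau>\<psi>[of "\<tau> s"] \<tau>strict[of s "\<psi> (\<tau> s)"] \<tau>strict[of "\<psi> (\<tau> s)" s] by (cases s "\<psi> (\<tau> s)" rule: linorder_cases) auto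
  have \<psi>mono: "\<psi> s < \<psi> t \<longleftrightarrow> s < t" for s t using \<tau>iff[of "\<psi> s" "\<psi> t"] by (simp add: \<tau>\<psi>)
  have sm: "strict_mono \<psi>" using \<psi>mono by (simp add: strict_mono_def)
  have m\<tau>: "mono \<tau>" using \<tau>strict by (auto simp: mono_def le_less)
  have [measurable]: "\<tau> \<in> borel_measurable borel" "\<psi> \<in> borel_measurable borel"
    using m\<tau> strict_mono_mono[OF sm] by (auto intro: borel_measurable_mono)
  have \<psi>diff: "t - s = \<psi> t - \<psi> s + (LINT r:{\<psi> s<..\<psi> t}|lborel. w r - 1)" if "s \<le> t" for s t
    using \<tau>diff[of "\<psi> s" "\<psi> t"] strict_monoD[OF sm] that by (auto simp: \<tau>\<psi> le_less)
  \<comment> \<open>Lebesgue measure is determined by its values on boxes, and \<open>\<tau>\<close>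
    pulls \<open>{l<..<u}\<close> back to \<open>{\<psi> l<..<\<psi> u}\<close>, whose
    \<open>w\<close>-mass is \<open>u - l\<close> by \<open>\<psi>diff\<close>.\<close>
  have lb: "lborel = distr (density lborel w) borel \<tau>"
  proof (rule lborel_eqI)
    fix l u :: real assume "\<And>b. b \<in> Basis \<Longrightarrow> l \<bullet> b \<le> u \<bullet> b"
    then have lu: "l \<le> u" by simp
    then have \<psi>lu: "\<psi> l \<le> \<psi> u" using strict_mono_less_eq[OF sm] by simp
    have "\<tau> -` {l<..<u} = {\<psi> l<..<\<psi> u}"
      using \<tau>iff \<tau>\<psi> by (auto) (metis \<tau>iff \<tau>\<psi>)+
    then have "emeasure (distr (density lborel w) borel \<tau>) {l<..<u} = emeasure (density lborel w) {\<psi> l<..<\<psi> u}"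
      by (subst emeasure_distr) auto
    also have "\<dots> = (\<integral>\<^sup>+s. ennreal (w s) * indicator {\<psi> l<..<\<psi> u} s \<partial>lborel)"
      by (subst emeasure_density) auto
    \<comment> \<open>\<open>w\<close> is split as \<open>1 + (w - 1)\<close> because integrability
      is known for \<open>w - 1\<close>; the added end point \<open>\<psi> u\<close> is
      null.\<close>
    also have "\<dots> = (\<integral>\<^sup>+s. ennreal (indicator {\<psi> l<..\<psi> u} s + indicator {\<psi> l<..\<psi> u} s *\<^sub>R (w s - 1)) \<partial>lborel)"
    proof (rule nn_integral_cong_AE)
      show "AE s in lborel. ennreal (w s) * indicator {\<psi> l<..<\<psi> u} s =
          ennreal (indicator {\<psi> l<..\<psi> u} s + indicator {\<psi> l<..\<psi> u} s *\<^sub>R (w s - 1))"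
        using AE_lborel_singleton[of "\<psi> u"] by eventually_elim (auto simp: indicator_def)
    qed
    also have "\<dots> = ennreal (LINT s|lborel. indicator {\<psi> l<..\<psi> u} s + indicator {\<psi> l<..\<psi> u} s *\<^sub>R (w s - 1))"
      using si[of "{\<psi> l<..\<psi> u}"] \<psi>lu w1 unfolding set_integrable_def
      by (intro nn_integral_eq_integral Bochner_Integration.integrable_add integrable_real_indicator) (auto simp: indicator_def)
    also have "(LINT s|lborel. indicator {\<psi> l<..\<psi> u} s + indicator {\<psi> l<..\<psi> u} s *\<^sub>R (w s - 1)) = u - l"
      using si[of "{\<psi> l<..\<psi> u}"] \<psi>lu \<psi>diff[OF lu] unfolding set_integrable_def set_lebesgue_integral_def
      by (subst Bochner_Integration.integral_add) (auto intro!: integrable_real_indicator)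
    finally show "emeasure (distr (density lborel w) borel \<tau>) (box l u) = ennreal (\<Prod>b\<in>Basis. (u - l) \<bullet> b)"
      using lu by (simp add: box_real)
  qed simp
  have nn: "(\<integral>\<^sup>+t. f (\<psi> t) \<partial>lborel) = (\<integral>\<^sup>+s. f s * ennreal (w s) \<partial>lborel)" if [measurable]: "f \<in> borel_measurable borel" for f
  proof -
    have "(\<integral>\<^sup>+t. f (\<psi> t) \<partial>lborel) = (\<integral>\<^sup>+s. f (\<psi> (\<tau> s)) \<partial>density lborel w)"
      by (subst lb, subst nn_integral_distr) auto
    also have "\<dots> = (\<integral>\<^sup>+s. f s * ennreal (w s) \<partial>lborel)"
      by (subst nn_integral_density) (auto simp: \<psi>\<tau> mult.commute)
    finally show ?thesis .
  qed
  have "AE s in lborel. (F has_real_derivative w s - 1) (at s)"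
    unfolding F_def by (rule Lebesgue_differentiation[OF int])
  then have "AE s in lborel. (\<tau> has_real_derivative w s) (at s)"
    by eventually_elim (auto simp: \<tau>_def[abs_def] intro!: derivative_eq_intros)
  from AE_time_change[OF nn _ this]
  have "AE t in lborel. (\<tau> has_real_derivative w (\<psi> t)) (at (\<psi> t))" by simp
  then have der: "AE t in lborel. (\<psi> has_real_derivative inverse (w (\<psi> t))) (at t)"
  proof eventually_elim
    case (elim t)
    have lip: "dist (\<psi> s) (\<psi> t) \<le> dist s t" for s
      using \<tau>ge[of "\<psi> s" "\<psi> t"] \<tau>ge[of "\<psi> t" "\<psi> s"] \<psi>mono[of s t] \<psi>mono[of t s]
      by (cases s t rule: linorder_cases) (simp_all add: \<tau>\<psi> dist_real_def)
    have "isCont \<psi> t"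
      unfolding continuous_at_eps_delta using lip le_less_trans by blast
    then show ?case
      using w1[of "\<psi> t"] by (intro DERIV_inverse_function[where f=\<tau> and a="t - 1" and b="t + 1"] elim) (auto simp: \<tau>\<psi>)
  qed
  have "\<psi> 0 = 0" using \<psi>\<tau>[of 0] \<tau>0 by simp
  then show ?thesis using sm \<psi>diff nn der unfolding is_time_change_def by blast
qed

section \<open>Approximation in L^p by bounded continuous functions\<close>

lemma powr_add_le:
  fixes a b p :: real
  assumes "0 \<le> a" "0 \<le> b" "0 \<le> p"
  shows "(a + b) powr p \<le> 2 powr p * (a powr p + b powr p)"
proof -
  have "(a + b) powr p \<le> (2 * max a b) powr p" using assms by (intro powr_mono2) auto
  also have "\<dots> = 2 powr p * max a b powr p" by (rule powr_mult)
  also have "max a b powr p \<le> a powr p + b powr p" by (auto simp: max_def)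
  finally show ?thesis by simp
qed

text \<open>Truncation at a high level costs little by dominated convergence. The truncated function
  is an almost everywhere limit of continuous functions truncated at the same level, for which a
  constant dominates on \<open>{0..1}\<close>. The bound \<open>K\<close> later allows dominated
  convergence for \<open>k\<close> composed with time changes.\<close>

lemma Lp_approx_bounded_continuous:
  fixes v :: "real \<Rightarrow> real"
  assumes [measurable]: "v \<in> borel_measurable borel" and p: "0 < p"
    and fin: "(\<integral>\<^sup>+t\<in>{0..1}. ennreal (\<bar>v t\<bar> powr p) \<partial>lborel) < \<infinity>" and e: "(e::real) > 0"
  obtains k K where "continuous_on UNIV k" "\<And>t. \<bar>k t\<bar> \<le> K"
    "(\<integral>\<^sup>+t\<in>{0..1}. ennreal (\<bar>v t - k t\<bar> powr p) \<partial>lborel) < ennreal e"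
proof -
  obtain N G where N: "negligible N" and G: "\<And>n. continuous_on UNIV (G n)"
    "\<And>x. x \<notin> N \<Longrightarrow> (\<lambda>n. G n x) \<longlonglongrightarrow> v x"
    using lebesgue_measurable_imp_measurable_on_real[of v UNIV] unfolding measurable_on_def
    by (auto simp: measurable_completion)
  have NAE: "AE x in lborel. x \<notin> N"
    using N unfolding negligible_iff_null_sets by (metis AE_not_in AE_completion_iff)
  define cl :: "real \<Rightarrow> real \<Rightarrow> real" where "cl K x = max (-K) (min x K)" for K x
  have cl_cont: "continuous_on UNIV (cl K)" for K unfolding cl_def by (intro continuous_intros)
  have [measurable]: "cl K \<in> borel_measurable borel" for K unfolding cl_def by measurable
  have [measurable]: "G n \<in> borel_measurable borel" for n
    using G(1) by (rule borel_measurable_continuous_onI)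
  let ?c = "ennreal (2 powr p)"
  have c: "?c > 0" "?c < \<infinity>" by auto
  let ?I = "\<lambda>f. \<integral>\<^sup>+t. ennreal (\<bar>f t\<bar> powr p) * indicator {0..1} t \<partial>lborel"
  have "(\<lambda>n. ?I (\<lambda>t. v t - cl (real n) (v t))) \<longlonglongrightarrow> (\<integral>\<^sup>+t. 0 \<partial>(lborel :: real measure))"
  proof (rule nn_integral_dominated_convergence[where w="\<lambda>t. ennreal (\<bar>v t\<bar> powr p) * indicator {0..1} t"])
    show "AE t in lborel. ennreal (\<bar>v t - cl (real n) (v t)\<bar> powr p) * indicator {0..1} t \<le> ennreal (\<bar>v t\<bar> powr p) * indicator {0..1} t" for n
      using p by (intro AE_I2 mult_right_mono ennreal_leI powr_mono2) (auto simp: cl_def)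
    show "AE t in lborel. (\<lambda>n. ennreal (\<bar>v t - cl (real n) (v t)\<bar> powr p) * indicator {0..1} t) \<longlonglongrightarrow> 0"
    proof (intro AE_I2)
      fix t
      obtain m where m: "\<bar>v t\<bar> \<le> real m" using real_arch_simple by blast
      have "cl (real n) (v t) = v t" if "n \<ge> m" for n
        using m that by (auto simp: cl_def)
      then show "(\<lambda>n. ennreal (\<bar>v t - cl (real n) (v t)\<bar> powr p) * indicator {0..1} t) \<longlonglongrightarrow> 0"
        using p by (intro tendsto_eventually eventually_sequentiallyI[of m]) auto
    qed
  qed (use fin in auto)
  \<comment> \<open>Two errors of this size, combined by \<open>powr_add_le\<close> at the price of
    a factor \<open>2 powr p\<close>, make up \<open>e\<close>.\<close>
  then have "\<forall>\<^sub>F n in sequentially. ?I (\<lambda>t. v t - cl (real n) (v t)) < ennreal (e / 2 / 2 powr p)"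
    using c e by (intro order_tendstoD) auto
  then obtain n where n: "?I (\<lambda>t. v t - cl (real n) (v t)) < ennreal (e / 2 / 2 powr p)"
    by (auto simp: eventually_sequentially)
  let ?K = "real n"
  have "(\<lambda>m. ?I (\<lambda>t. cl ?K (v t) - cl ?K (G m t))) \<longlonglongrightarrow> (\<integral>\<^sup>+t. 0 \<partial>(lborel :: real measure))"
  proof (rule nn_integral_dominated_convergence[where w="\<lambda>t. ennreal ((2 * ?K) powr p) * indicator {0..1} t"])
    show "AE t in lborel. ennreal (\<bar>cl ?K (v t) - cl ?K (G m t)\<bar> powr p) * indicator {0..1} t \<le> ennreal ((2 * ?K) powr p) * indicator {0..1} t" for m
      using p by (intro AE_I2 mult_right_mono ennreal_leI powr_mono2) (auto simp: cl_def)
    show "AE t in lborel. (\<lambda>m. ennreal (\<bar>cl ?K (v t) - cl ?K (G m t)\<bar> powr p) * indicator {0..1} t) \<longlonglongrightarrow> 0"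
      using NAE
    proof eventually_elim
      case (elim t)
      have "(\<lambda>m. cl ?K (G m t)) \<longlonglongrightarrow> cl ?K (v t)"
        unfolding cl_def by (intro tendsto_intros G(2) elim)
      then have "(\<lambda>m. \<bar>cl ?K (v t) - cl ?K (G m t)\<bar>) \<longlonglongrightarrow> 0"
        by (intro tendsto_rabs_zero) (auto intro: tendsto_eq_intros)
      then have "(\<lambda>m. \<bar>cl ?K (v t) - cl ?K (G m t)\<bar> powr p) \<longlonglongrightarrow> 0"
        using p by (intro tendsto_zero_powrI[where b=p]) auto
      then have "(\<lambda>m. ennreal (\<bar>cl ?K (v t) - cl ?K (G m t)\<bar> powr p)) \<longlonglongrightarrow> 0"
        by (simp add: tendsto_ennreal_iff[of _ _ 0, simplified] flip: ennreal_0)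
      then show ?case by (cases "t \<in> {0..1}") auto
    qed
  qed (auto simp: nn_integral_cmult ennreal_mult_less_top)
  then have "\<forall>\<^sub>F m in sequentially. ?I (\<lambda>t. cl ?K (v t) - cl ?K (G m t)) < ennreal (e / 2 / 2 powr p)"
    using c e by (intro order_tendstoD) auto
  then obtain m where m: "?I (\<lambda>t. cl ?K (v t) - cl ?K (G m t)) < ennreal (e / 2 / 2 powr p)"
    by (auto simp: eventually_sequentially)
  show thesis
  proof
    show "continuous_on UNIV (\<lambda>t. cl ?K (G m t))"
      by (rule continuous_on_compose2[OF cl_cont G(1)]) auto
    show "\<bar>cl ?K (G m t)\<bar> \<le> ?K" for t by (auto simp: cl_def)
    have "?I (\<lambda>t. v t - cl ?K (G m t)) \<le> (\<integral>\<^sup>+t. ?c * (ennreal (\<bar>v t - cl ?K (v t)\<bar> powr p) * indicator {0..1} t + ennreal (\<bar>cl ?K (v t) - cl ?K (G m t)\<bar> powr p) * indicator {0..1} t) \<partial>lborel)"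
    proof (rule nn_integral_mono)
      fix t
      have "\<bar>v t - cl ?K (G m t)\<bar> powr p \<le> (\<bar>v t - cl ?K (v t)\<bar> + \<bar>cl ?K (v t) - cl ?K (G m t)\<bar>) powr p"
        using p by (intro powr_mono2) auto
      also have "\<dots> \<le> 2 powr p * (\<bar>v t - cl ?K (v t)\<bar> powr p + \<bar>cl ?K (v t) - cl ?K (G m t)\<bar> powr p)"
        using p by (intro powr_add_le) auto
      finally show "ennreal (\<bar>v t - cl ?K (G m t)\<bar> powr p) * indicator {0..1} t \<le> ?c * (ennreal (\<bar>v t - cl ?K (v t)\<bar> powr p) * indicator {0..1} t + ennreal (\<bar>cl ?K (v t) - cl ?K (G m t)\<bar> powr p) * indicator {0..1} t)"
        by (auto simp: indicator_def simp flip: ennreal_plus ennreal_mult intro!: ennreal_leI)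
    qed
    also have "\<dots> = ?c * (?I (\<lambda>t. v t - cl ?K (v t)) + ?I (\<lambda>t. cl ?K (v t) - cl ?K (G m t)))"
      by (subst nn_integral_cmult) (auto simp: nn_integral_add)
    also have "\<dots> < ?c * (ennreal (e / 2 / 2 powr p) + ennreal (e / 2 / 2 powr p))"
      using c n m by (intro ennreal_mult_strict_left_mono add_strict_mono) auto
    also have "\<dots> = ennreal e"
      using e by (simp flip: ennreal_plus ennreal_mult)
    finally show "?I (\<lambda>t. v t - cl ?K (G m t)) < ennreal e" .
  qed
qed

section \<open>Lipschitz approximation\<close>

lemma tendsto_ennreal_zeroI:
  fixes f :: "'a \<Rightarrow> ennreal"
  assumes "\<And>e :: real. e > 0 \<Longrightarrow> \<forall>\<^sub>F x in F. f x < ennreal e"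
  shows "(f \<longlongrightarrow> 0) F"
proof (rule order_tendstoI)
  fix a :: ennreal assume "0 < a"
  then obtain e :: real where "0 < e" "ennreal e < a"
    by (metis dense ennreal_cases ennreal_less_zero_iff infinity_ennreal_def less_top not_less_iff_gr_or_eq)
  then show "\<forall>\<^sub>F x in F. f x < a"
    using assms[of e] by (auto elim: eventually_mono)
qed auto

text \<open>\<open>q s\<close> is the slope substituted at time \<open>s\<close> when
  \<open>v s\<close> is too large; it will be one of the two functions \<rho> along
  \<open>Y\<close>, chosen by the sign of \<open>v s\<close>. Everything is phrased with Borel
  functions \<open>v\<close> and \<open>d h\<close> on the line, so that \<open>deriv_on\<close>
  enters only in the final theorem.\<close>

theorem Lipschitz_approximation:
  fixes L :: "real \<times> real \<Rightarrow> ennreal" and v q :: "real \<Rightarrow> real" and p c R :: real and C :: ennreal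
  defines "Y \<equiv> \<lambda>t. LINT s:{..t}|lborel. v s"
  assumes [measurable]: "L \<in> borel_measurable borel" "q \<in> borel_measurable borel"
    and p: "1 \<le> p" and v: "integrable lborel v" and supp: "\<And>s. s \<notin> {0<..1} \<Longrightarrow> v s = 0"
    and vp: "(\<integral>\<^sup>+t\<in>{0..1}. ennreal (\<bar>v t\<bar> powr p) \<partial>lborel) < \<infinity>"
    and c: "0 < c" "\<And>s. c \<le> \<bar>q s\<bar>" "\<And>s. \<bar>q s\<bar> \<le> R"
    and sgn: "\<And>s. v s \<noteq> 0 \<Longrightarrow> 0 < v s * q s"
    and C: "C < \<infinity>" "\<And>s. s \<in> {0..1} \<Longrightarrow> L (Y s, q s) \<le> C"
    and Lv: "(\<integral>\<^sup>+t\<in>{0..1}. L (Y t, v t) \<partial>lborel) < \<infinity>"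
  obtains u d :: "nat \<Rightarrow> real \<Rightarrow> real" and B :: "nat \<Rightarrow> real"
  where "\<And>h. (B h)-lipschitz_on {0..1} (u h)" "\<And>h. u h 0 = 0"
    "\<And>h. d h \<in> borel_measurable borel" "\<And>h. AE t in lborel. (u h has_real_derivative d h t) (at t)"
    "\<And>h t. \<bar>d h t\<bar> \<le> B h"
    "(\<lambda>h. \<integral>\<^sup>+t\<in>{0..1}. L (u h t, d h t) \<partial>lborel) \<longlonglongrightarrow> (\<integral>\<^sup>+t\<in>{0..1}. L (Y t, v t) \<partial>lborel)"
    "(\<lambda>h. \<integral>\<^sup>+t\<in>{0..1}. ennreal (\<bar>u h t - Y t\<bar> powr p) \<partial>lborel) \<longlonglongrightarrow> 0"
    "(\<lambda>h. \<integral>\<^sup>+t\<in>{0..1}. ennreal (\<bar>d h t - v t\<bar> powr p) \<partial>lborel) \<longlonglongrightarrow> 0"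
proof -
  have [measurable]: "v \<in> borel_measurable borel" using borel_measurable_integrable[OF v] by simp
  have R: "R > 0" using c(1) c(2)[of 0] c(3)[of 0] by linarith
  define M where "M h = R + real h" for h
  have M: "M h > 0" "R \<le> M h" for h using R by (auto simp: M_def)
  have evM: "\<forall>\<^sub>F h in sequentially. \<bar>x\<bar> \<le> M h" for x
  proof -
    obtain n where "\<bar>x\<bar> \<le> real n" using real_arch_simple by blast
    then show ?thesis using R by (intro eventually_sequentiallyI[of n]) (auto simp: M_def)
  qed
  \<comment> \<open>Where the slope exceeds \<open>M h\<close>, time is slowed down exactly so that \<open>Y\<close> is traversed with
    speed \<open>q\<close>. Since \<open>M h \<ge> R\<close>, time is never accelerated, so no extra time has to be filled at
    the end.\<close>
  define w where "w h s = (if \<bar>v s\<bar> > M h then v s / q s else 1)" for h s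
  define g where "g h s = (if \<bar>v s\<bar> > M h then q s else v s)" for h s
  have [measurable]: "w h \<in> borel_measurable borel" "g h \<in> borel_measurable borel" for h
    unfolding w_def g_def by measurable
  have quot: "v s / q s = \<bar>v s\<bar> / \<bar>q s\<bar>" for s
    using sgn[of s] by (cases "v s = 0") (auto simp: zero_less_mult_iff)
  have q0: "\<bar>q s\<bar> > 0" "q s \<noteq> 0" for s using c(1) c(2)[of s] by auto
  have w1: "1 \<le> w h s" for h s
    using M(2)[of h] c(3)[of s] q0[of s] by (auto simp: w_def quot pos_le_divide_eq simp del: abs_divide)
  \<comment> \<open>An integrable bound on \<open>w h - 1\<close> that does not depend on
    \<open>h\<close>; the lower bound \<open>c\<close> of \<open>\<bar>q\<bar>\<close> is used
    here.\<close>
  have wle: "w h s \<le> 1 + \<bar>v s\<bar> / c" for h s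
  proof -
    have "\<bar>v s\<bar> / \<bar>q s\<bar> \<le> \<bar>v s\<bar> / c" using c(1,2) by (intro divide_left_mono) (auto intro: mult_pos_pos q0)
    then show ?thesis using c(1) by (auto simp: w_def quot simp del: abs_divide)
  qed
  \<comment> \<open>In the new time the curve has speed \<open>\<bar>v\<bar> / w h\<close>;
    integrated over \<open>{\<psi> h s<..\<psi> h t}\<close>, this bound gives the Lipschitz
    constant \<open>M h\<close>.\<close>
  have vw: "\<bar>v s\<bar> \<le> M h * w h s" for h s
  proof (cases "\<bar>v s\<bar> > M h")
    case True
    have "\<bar>v s\<bar> * \<bar>q s\<bar> \<le> \<bar>v s\<bar> * M h" using c(3)[of s] M(2)[of h] by (intro mult_left_mono) auto
    then show ?thesis using True q0[of s] by (simp add: w_def quot field_simps del: abs_divide)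
  qed (simp add: w_def)
  have vc: "integrable lborel (\<lambda>s. \<bar>v s\<bar> / c)" using v by auto
  have wint: "integrable lborel (\<lambda>s. w h s - 1)" for h
    by (rule Bochner_Integration.integrable_bound[OF vc]) (use w1 wle c(1) in \<open>auto simp: abs_le_iff algebra_simps\<close>)
  have wsupp: "w h s = 1" if "s \<notin> {0<..1}" for h s using supp[OF that] M(1)[of h] by (simp add: w_def)
  have wlim: "\<forall>\<^sub>F h in sequentially. w h s = 1 \<and> g h s = v s" for s
    using evM[of "v s"] by eventually_elim (auto simp: w_def g_def)
  have "\<exists>\<psi>. is_time_change (w h) \<psi>" for h
    by (rule time_change_exists) (use w1 wint wsupp in auto)
  then obtain \<psi> where tc: "\<And>h. is_time_change (w h) (\<psi> h)" by metis
  have \<psi>0: "\<psi> h 0 = 0" and sm: "strict_mono (\<psi> h)" for h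
    using tc[of h] by (auto simp: is_time_change_def)
  have \<psi>diff: "s \<le> t \<Longrightarrow> t - s = \<psi> h t - \<psi> h s + (LINT r:{\<psi> h s<..\<psi> h t}|lborel. w h r - 1)" for s t h
    using tc[of h] unfolding is_time_change_def by blast
  have nn: "f \<in> borel_measurable borel \<Longrightarrow> (\<integral>\<^sup>+t. f (\<psi> h t) \<partial>lborel) = (\<integral>\<^sup>+s. f s * ennreal (w h s) \<partial>lborel)" for f h
    using tc[of h] unfolding is_time_change_def by blast
  have \<psi>der: "AE t in lborel. (\<psi> h has_real_derivative inverse (w h (\<psi> h t))) (at t)" for h
    using tc[of h] unfolding is_time_change_def by blast
  have \<psi>le: "\<psi> h s \<le> \<psi> h t \<longleftrightarrow> s \<le> t" for h s t by (rule strict_mono_less_eq[OF sm])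
  have [measurable]: "\<psi> h \<in> borel_measurable borel" for h
    using strict_mono_mono[OF sm] by (rule borel_measurable_mono)
  \<comment> \<open>An upper bound for the delay \<open>t - \<psi> h t\<close> at all times
    \<open>t \<ge> 0\<close>.\<close>
  define \<eta> where "\<eta> h = (LINT r|lborel. w h r - 1)" for h
  have \<eta>: "\<eta> \<longlonglongrightarrow> 0"
  proof -
    have "(\<lambda>h. LINT r|lborel. w h r - 1) \<longlonglongrightarrow> (LINT r|(lborel :: real measure). 0)"
    proof (rule integral_dominated_convergence[where w="\<lambda>s. \<bar>v s\<bar> / c"])
      show "AE s in lborel. (\<lambda>h. w h s - 1) \<longlonglongrightarrow> 0"
      proof (intro AE_I2 tendsto_eventually)
        show "\<forall>\<^sub>F h in sequentially. w h s - 1 = 0" for s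
          using wlim[of s] by eventually_elim simp
      qed
      show "AE s in lborel. norm (w h s - 1) \<le> \<bar>v s\<bar> / c" for h
        using w1[of h] wle[of h] by (intro AE_I2) (auto simp: algebra_simps)
    qed (use vc in auto)
    then show ?thesis by (simp add: \<eta>_def[abs_def])
  qed
  have \<psi>t: "0 \<le> \<psi> h t" "\<psi> h t \<le> t" "t - \<psi> h t \<le> \<eta> h" if "0 \<le> t" for h t
  proof -
    have e: "t - \<psi> h t = (LINT r:{\<psi> h 0<..\<psi> h t}|lborel. w h r - 1)" using \<psi>diff[OF that, of h] \<psi>0[of h] by simp
    show "0 \<le> \<psi> h t" using \<psi>le[of h 0 t] \<psi>0[of h] that by simp
    have "0 \<le> (LINT r:{\<psi> h 0<..\<psi> h t}|lborel. w h r - 1)"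
      unfolding set_lebesgue_integral_def using w1 by (intro integral_nonneg_AE) (auto simp: indicator_def)
    then show "\<psi> h t \<le> t" using e by simp
    show "t - \<psi> h t \<le> \<eta> h"
      unfolding e \<eta>_def set_lebesgue_integral_def
      using w1 wint by (intro integral_mono integrable_mult_indicator) (auto simp: indicator_def)
  qed
  have \<psi>lim: "(\<lambda>h. \<psi> h t) \<longlonglongrightarrow> t" if "0 \<le> t" for t
  proof (rule tendsto_sandwich)
    show "(\<lambda>h. t - \<eta> h) \<longlonglongrightarrow> t" using tendsto_diff[OF tendsto_const \<eta>, of t] by simp
    show "\<forall>\<^sub>F h in sequentially. t - \<eta> h \<le> \<psi> h t" "\<forall>\<^sub>F h in sequentially. \<psi> h t \<le> t"
      using \<psi>t[OF that] by (auto simp: algebra_simps intro!: always_eventually)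
  qed simp
  have Ycont: "continuous_on UNIV Y" unfolding Y_def by (rule continuous_on_indefinite[OF v])
  then have [measurable]: "Y \<in> borel_measurable borel" by (rule borel_measurable_continuous_onI)
  have si: "set_integrable lborel A f" if "integrable lborel f" "A \<in> sets borel" for A and f :: "real \<Rightarrow> real"
    unfolding set_integrable_def using that by (intro integrable_mult_indicator) auto
  have "Y 0 = (LINT r|(lborel :: real measure). (0::real))"
    unfolding Y_def set_lebesgue_integral_def
    by (intro Bochner_Integration.integral_cong) (use supp in \<open>auto simp: indicator_def\<close>)
  then have Y0: "Y 0 = 0" by simp
  have Ybound: "\<bar>Y t\<bar> \<le> (LINT s|lborel. \<bar>v s\<bar>)" for t
  proof -
    have "\<bar>Y t\<bar> \<le> (LINT s|lborel. \<bar>indicator {..t} s *\<^sub>R v s\<bar>)"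
      unfolding Y_def set_lebesgue_integral_def by (rule integral_abs_bound)
    also have "\<dots> \<le> (LINT s|lborel. \<bar>v s\<bar>)"
      using v by (intro integral_mono integrable_abs integrable_mult_indicator) (auto simp: indicator_def)
    finally show ?thesis .
  qed
  \<comment> \<open>The integrand \<open>H\<close> of time and slope is general because it is used
    twice: for \<open>L\<close> along \<open>Y\<close>, and for the \<open>p\<close>-th power of the
    distance of the slope to a continuous function.\<close>
  have conv: "(\<lambda>h. \<integral>\<^sup>+t\<in>{0..1}. H (\<psi> h t, g h (\<psi> h t)) \<partial>lborel) \<longlonglongrightarrow> (\<integral>\<^sup>+t\<in>{0..1}. H (t, v t) \<partial>lborel)"
    if Hm[measurable]: "H \<in> borel_measurable borel" and D: "D < \<infinity>" "\<And>s. s \<in> {0..1} \<Longrightarrow> H (s, q s) \<le> D"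
      and Hv: "(\<integral>\<^sup>+t\<in>{0..1}. H (t, v t) \<partial>lborel) < \<infinity>" for H :: "real \<times> real \<Rightarrow> ennreal" and D
  proof -
    have [measurable]: "(\<lambda>s. H (s, f s)) \<in> borel_measurable borel" if [measurable]: "f \<in> borel_measurable borel" for f
      by (rule measurable_compose[OF _ Hm]) (rule borel_measurable_Pair, auto)
    \<comment> \<open>In the original time the curve is run only over
      \<open>{0..\<psi> h 1}\<close>, whence an indicator that varies with \<open>h\<close>.\<close>
    have eq: "(\<integral>\<^sup>+t\<in>{0..1}. H (\<psi> h t, g h (\<psi> h t)) \<partial>lborel) = (\<integral>\<^sup>+s. H (s, g h s) * indicator {0..\<psi> h 1} s * ennreal (w h s) \<partial>lborel)" for h
    proof -
      have "indicator {0..1} t = (indicator {0..\<psi> h 1} (\<psi> h t) :: ennreal)" for t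
        using \<psi>le[of h 0 t] \<psi>le[of h t 1] \<psi>0[of h] by (auto simp: indicator_def)
      then show ?thesis by (simp add: nn[of "\<lambda>s. H (s, g h s) * indicator {0..\<psi> h 1} s" h])
    qed
    show ?thesis
      unfolding eq
    proof (rule nn_integral_dominated_convergence[where w="\<lambda>s. H (s, v s) * indicator {0..1} s + D * ennreal (\<bar>v s\<bar> / c)"])
      \<comment> \<open>The first summand covers kept slopes, where \<open>w h s = 1\<close>; the
        second covers replaced slopes, where \<open>H\<close> is at most \<open>D\<close> and
        \<open>w h s\<close> at most \<open>\<bar>v s\<bar> / c\<close>.\<close>
      show "AE s in lborel. H (s, g h s) * indicator {0..\<psi> h 1} s * ennreal (w h s) \<le> H (s, v s) * indicator {0..1} s + D * ennreal (\<bar>v s\<bar> / c)" for h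
      proof (rule AE_I2)
        fix s
        show "H (s, g h s) * indicator {0..\<psi> h 1} s * ennreal (w h s) \<le> H (s, v s) * indicator {0..1} s + D * ennreal (\<bar>v s\<bar> / c)"
        proof (cases "s \<in> {0..\<psi> h 1}")
          case True
          then have s: "s \<in> {0..1}" using \<psi>t(2)[of 1 h] by auto
          show ?thesis
          proof (cases "\<bar>v s\<bar> > M h")
            case big: True
            have "w h s \<le> \<bar>v s\<bar> / c"
              using big c(1) c(2)[of s] q0[of s] by (simp add: w_def quot frac_le)
            then have "H (s, q s) * ennreal (w h s) \<le> D * ennreal (\<bar>v s\<bar> / c)"
              by (intro mult_mono D(2) s ennreal_leI) auto
            then show ?thesis using big True by (simp add: g_def add_increasing)
          next
            case False
            then show ?thesis using True s by (simp add: g_def w_def)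
          qed
        qed simp
      qed
      \<comment> \<open>At \<open>s = 1\<close> the indicator need not tend to 1, as
        \<open>\<psi> h 1\<close> may stay below 1 for every \<open>h\<close>.\<close>
      show "AE s in lborel. (\<lambda>h. H (s, g h s) * indicator {0..\<psi> h 1} s * ennreal (w h s)) \<longlonglongrightarrow> H (s, v s) * indicator {0..1} s"
        using AE_lborel_singleton[of 1]
      proof eventually_elim
        case (elim s)
        have "\<forall>\<^sub>F h in sequentially. indicator {0..\<psi> h 1} s = (indicator {0..1} s :: ennreal)"
        proof (cases "s < 1")
          case True
          have "\<forall>\<^sub>F h in sequentially. s < \<psi> h 1" using order_tendstoD(1)[OF \<psi>lim True] by simp
          then show ?thesis by eventually_elim (use True in \<open>auto simp: indicator_def\<close>)
        next
          case False
          have "\<not> s \<le> \<psi> h 1" for h using \<psi>t(2)[of 1 h] elim False by simp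
          then show ?thesis using elim False by (simp add: indicator_def)
        qed
        with wlim[of s] have "\<forall>\<^sub>F h in sequentially. H (s, g h s) * indicator {0..\<psi> h 1} s * ennreal (w h s) = H (s, v s) * indicator {0..1} s"
          by eventually_elim simp
        then show ?case by (rule tendsto_eventually)
      qed
      have "(\<integral>\<^sup>+s. ennreal (\<bar>v s\<bar> / c) \<partial>lborel) < \<infinity>"
        using vc c(1) by (subst nn_integral_eq_integral) auto
      then show "(\<integral>\<^sup>+s. H (s, v s) * indicator {0..1} s + D * ennreal (\<bar>v s\<bar> / c) \<partial>lborel) < \<infinity>"
        using Hv D(1) by (simp add: nn_integral_add nn_integral_cmult ennreal_mult_less_top)
    qed auto
  qed
  show thesis
  proof
    fix h :: nat
    show "Y (\<psi> h 0) = 0" by (simp add: \<psi>0 Y0)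
    show "(\<lambda>t. g h (\<psi> h t)) \<in> borel_measurable borel" by measurable
    show "\<bar>g h (\<psi> h t)\<bar> \<le> M h" for t
      using c(3)[of "\<psi> h t"] M(2)[of h] by (auto simp: g_def)
    have lip: "\<bar>Y (\<psi> h t) - Y (\<psi> h s)\<bar> \<le> M h * (t - s)" if "s \<le> t" for s t
    proof -
      let ?a = "\<psi> h s" and ?b = "\<psi> h t"
      have ab: "?a \<le> ?b" using that \<psi>le by simp
      have wi: "integrable lborel (\<lambda>r. indicator {?a<..?b} r + indicator {?a<..?b} r *\<^sub>R (w h r - 1))"
        using si[OF wint, of "{?a<..?b}"] ab unfolding set_integrable_def
        by (intro Bochner_Integration.integrable_add integrable_real_indicator) auto
      have "\<bar>Y ?b - Y ?a\<bar> \<le> (LINT r|lborel. \<bar>indicator {?a<..?b} r *\<^sub>R v r\<bar>)"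
        unfolding Y_def has_integral_indefinite_diff(2)[OF v ab] unfolding set_lebesgue_integral_def by (rule integral_abs_bound)
      \<comment> \<open>This is \<open>vw\<close> integrated, with \<open>w h\<close> written as
        \<open>1 + (w h - 1)\<close> so that \<open>\<psi>diff\<close> evaluates the integral to
        \<open>t - s\<close>.\<close>
      also have "\<dots> \<le> (LINT r|lborel. M h * (indicator {?a<..?b} r + indicator {?a<..?b} r *\<^sub>R (w h r - 1)))"
        using v wi vw[of _ h] by (intro integral_mono integrable_abs integrable_mult_indicator integrable_mult_right) (auto simp: indicator_def)
      also have "\<dots> = M h * ((LINT r|lborel. indicator {?a<..?b} r) + (LINT r:{?a<..?b}|lborel. w h r - 1))"
        using si[OF wint, of "{?a<..?b}"] ab unfolding set_integrable_def set_lebesgue_integral_def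
        by (subst integral_mult_right_zero, subst Bochner_Integration.integral_add) (auto intro!: integrable_real_indicator)
      also have "\<dots> = M h * (t - s)" using \<psi>diff[OF that, of h] ab by simp
      finally show ?thesis .
    qed
    have "dist (Y (\<psi> h s)) (Y (\<psi> h t)) \<le> M h * dist s t" for s t
      using lip[of s t] lip[of t s] by (cases "s \<le> t") (simp_all add: dist_real_def abs_minus_commute)
    then show "(M h)-lipschitz_on {0..1} (\<lambda>t. Y (\<psi> h t))"
      using M(1)[of h] by (intro lipschitz_onI) auto
    have "AE s in lborel. (Y has_real_derivative v s) (at s)"
      unfolding Y_def by (rule Lebesgue_differentiation[OF v])
    from AE_time_change[OF nn _ this]
    have "AE t in lborel. (Y has_real_derivative v (\<psi> h t)) (at (\<psi> h t))" by simp
    with \<psi>der[of h] show "AE t in lborel. ((\<lambda>t. Y (\<psi> h t)) has_real_derivative g h (\<psi> h t)) (at t)"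
    proof eventually_elim
      case (elim t)
      \<comment> \<open>On the slowed part this is \<open>v / (v / q) = q\<close>; there
        \<open>v\<close> is nonzero because \<open>M h > 0\<close>.\<close>
      have "v (\<psi> h t) * inverse (w h (\<psi> h t)) = g h (\<psi> h t)"
        using M(1)[of h] q0[of "\<psi> h t"] by (auto simp: w_def g_def)
      then show ?case using DERIV_chain2[OF elim(2,1)] by simp
    qed
  next
    have [measurable]: "(\<lambda>s. (Y (fst s), snd s)) \<in> borel_measurable (borel :: (real \<times> real) measure)"
      by (intro borel_measurable_continuous_onI continuous_intros continuous_on_compose2[OF Ycont]) auto
    have "(\<lambda>s. L (Y (fst s), snd s)) \<in> borel_measurable borel" by measurable
    from conv[OF this C(1)] show "(\<lambda>h. \<integral>\<^sup>+t\<in>{0..1}. L (Y (\<psi> h t), g h (\<psi> h t)) \<partial>lborel) \<longlonglongrightarrow> (\<integral>\<^sup>+t\<in>{0..1}. L (Y t, v t) \<partial>lborel)"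
      using C(2) Lv by simp
  next
    \<comment> \<open>As \<open>\<psi> h t\<close> tends to \<open>t\<close>, dominated convergence
      applies to continuous \<open>k\<close>; it serves for \<open>Y\<close> itself and for the
      approximant of \<open>v\<close>.\<close>
    have cc: "(\<lambda>h. \<integral>\<^sup>+t\<in>{0..1}. ennreal (\<bar>k (\<psi> h t) - k t\<bar> powr p) \<partial>lborel) \<longlonglongrightarrow> 0"
      if k: "continuous_on UNIV k" "\<And>t. \<bar>k t\<bar> \<le> K" for k :: "real \<Rightarrow> real" and K
    proof -
      have [measurable]: "k \<in> borel_measurable borel" using k(1) by (rule borel_measurable_continuous_onI)
      have "(\<lambda>h. \<integral>\<^sup>+t\<in>{0..1}. ennreal (\<bar>k (\<psi> h t) - k t\<bar> powr p) \<partial>lborel) \<longlonglongrightarrow> (\<integral>\<^sup>+t. 0 \<partial>(lborel :: real measure))"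
      proof (rule nn_integral_dominated_convergence[where w="\<lambda>t. ennreal ((2 * K) powr p) * indicator {0..1} t"])
        show "AE t in lborel. ennreal (\<bar>k (\<psi> h t) - k t\<bar> powr p) * indicator {0..1} t \<le> ennreal ((2 * K) powr p) * indicator {0..1} t" for h
        proof (intro AE_I2 mult_right_mono ennreal_leI powr_mono2)
          show "\<bar>k (\<psi> h t) - k t\<bar> \<le> 2 * K" for t using k(2)[of t] k(2)[of "\<psi> h t"] by linarith
        qed (use p in auto)
        show "AE t in lborel. (\<lambda>h. ennreal (\<bar>k (\<psi> h t) - k t\<bar> powr p) * indicator {0..1} t) \<longlonglongrightarrow> 0"
        proof (rule AE_I2)
          fix t
          show "(\<lambda>h. ennreal (\<bar>k (\<psi> h t) - k t\<bar> powr p) * indicator {0..1} t) \<longlonglongrightarrow> 0"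
          proof (cases "t \<in> {0..1}")
            case True
            have "isCont k t" using k(1) by (simp add: continuous_on_eq_continuous_at)
            from isCont_tendsto_compose[OF this \<psi>lim] True
            have "(\<lambda>h. k (\<psi> h t)) \<longlonglongrightarrow> k t" by simp
            then have "(\<lambda>h. \<bar>k (\<psi> h t) - k t\<bar>) \<longlonglongrightarrow> 0"
              by (intro tendsto_rabs_zero) (auto intro: tendsto_eq_intros)
            then have "(\<lambda>h. \<bar>k (\<psi> h t) - k t\<bar> powr p) \<longlonglongrightarrow> 0"
              using p by (intro tendsto_zero_powrI[where b=p]) auto
            then have "(\<lambda>h. ennreal (\<bar>k (\<psi> h t) - k t\<bar> powr p)) \<longlonglongrightarrow> 0"
              by (simp add: tendsto_ennreal_iff[of _ _ 0, simplified] flip: ennreal_0)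
            then show ?thesis using True by simp
          qed simp
        qed
      qed (auto simp: nn_integral_cmult ennreal_mult_less_top)
      then show ?thesis by simp
    qed
    show "(\<lambda>h. \<integral>\<^sup>+t\<in>{0..1}. ennreal (\<bar>Y (\<psi> h t) - Y t\<bar> powr p) \<partial>lborel) \<longlonglongrightarrow> 0"
      by (rule cc[OF Ycont Ybound])
    show "(\<lambda>h. \<integral>\<^sup>+t\<in>{0..1}. ennreal (\<bar>g h (\<psi> h t) - v t\<bar> powr p) \<partial>lborel) \<longlonglongrightarrow> 0"
    proof (rule tendsto_ennreal_zeroI)
      fix e :: real assume e: "e > 0"
      define a where "a = 2 powr p"
      have a: "a > 0" by (simp add: a_def)
      \<comment> \<open>Chosen so that \<open>a * (e' + a * e') = e\<close>, the value of the bound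
        below when \<open>e'\<close> stands for \<open>?E\<close> and for the limit of
        \<open>?A\<close>.\<close>
      define e' where "e' = e / (a + a * a)"
      have e': "e' > 0" using e a by (auto simp: e'_def intro!: divide_pos_pos add_pos_pos)
      obtain k K where k: "continuous_on UNIV k" "\<And>t. \<bar>k t\<bar> \<le> K"
        "(\<integral>\<^sup>+t\<in>{0..1}. ennreal (\<bar>v t - k t\<bar> powr p) \<partial>lborel) < e'"
        using Lp_approx_bounded_continuous[OF _ _ vp e'] p by auto
      have [measurable]: "k \<in> borel_measurable borel" using k(1) by (rule borel_measurable_continuous_onI)
      let ?E = "\<integral>\<^sup>+t\<in>{0..1}. ennreal (\<bar>v t - k t\<bar> powr p) \<partial>lborel"
      let ?A = "\<lambda>h. \<integral>\<^sup>+t\<in>{0..1}. ennreal (\<bar>g h (\<psi> h t) - k (\<psi> h t)\<bar> powr p) \<partial>lborel"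
      let ?B = "\<lambda>h. \<integral>\<^sup>+t\<in>{0..1}. ennreal (\<bar>k (\<psi> h t) - k t\<bar> powr p) \<partial>lborel"
      have [measurable]: "(\<lambda>s. k (fst s)) \<in> borel_measurable (borel :: (real \<times> real) measure)"
        by (intro borel_measurable_continuous_onI continuous_intros continuous_on_compose2[OF k(1)]) auto
      have sndm[measurable]: "snd \<in> borel_measurable (borel :: (real \<times> real) measure)"
        by (intro borel_measurable_continuous_onI continuous_intros)
      have Hm: "(\<lambda>s. ennreal (\<bar>snd s - k (fst s)\<bar> powr p)) \<in> borel_measurable (borel :: (real \<times> real) measure)"
        by measurable
      \<comment> \<open>The new slope and \<open>k\<close> are compared in the original time by
        \<open>conv\<close>: the limit is the error of \<open>k\<close> against \<open>v\<close>,
        and on replaced slopes the integrand is at most \<open>(R + K) powr p\<close>.\<close>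
      have A: "?A \<longlonglongrightarrow> ?E"
      proof -
        have "ennreal (\<bar>q s - k s\<bar> powr p) \<le> ennreal ((R + K) powr p)" for s
          using c(3)[of s] k(2)[of s] p by (intro ennreal_leI powr_mono2) auto
        moreover have "?E < \<infinity>" using k(3) by (rule less_trans) simp
        ultimately show ?thesis
          using conv[OF Hm, of "ennreal ((R + K) powr p)"] by simp
      qed
      have bound: "(\<integral>\<^sup>+t\<in>{0..1}. ennreal (\<bar>g h (\<psi> h t) - v t\<bar> powr p) \<partial>lborel) \<le> ennreal a * (?A h + ennreal a * (?B h + ?E))" for h
      proof -
        \<comment> \<open>The chain leads from the new slope \<open>x\<close> to
          \<open>z = v t\<close> through \<open>y1 = k (\<psi> h t)\<close> and
          \<open>y2 = k t\<close>; each of the two splittings costs a factor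
          \<open>a\<close>.\<close>
        have pt: "\<bar>x - z\<bar> powr p \<le> a * (\<bar>x - y1\<bar> powr p + a * (\<bar>y1 - y2\<bar> powr p + \<bar>z - y2\<bar> powr p))" for x y1 y2 z :: real
        proof -
          have "\<bar>x - z\<bar> powr p \<le> (\<bar>x - y1\<bar> + \<bar>y1 - z\<bar>) powr p" using p by (intro powr_mono2) auto
          also have "\<dots> \<le> a * (\<bar>x - y1\<bar> powr p + \<bar>y1 - z\<bar> powr p)"
            unfolding a_def using p by (intro powr_add_le) auto
          also have "\<bar>y1 - z\<bar> powr p \<le> (\<bar>y1 - y2\<bar> + \<bar>z - y2\<bar>) powr p" using p by (intro powr_mono2) auto
          also have "\<dots> \<le> a * (\<bar>y1 - y2\<bar> powr p + \<bar>z - y2\<bar> powr p)"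
            unfolding a_def using p by (intro powr_add_le) auto
          finally show ?thesis using a by simp
        qed
        have "(\<integral>\<^sup>+t\<in>{0..1}. ennreal (\<bar>g h (\<psi> h t) - v t\<bar> powr p) \<partial>lborel) \<le>
          (\<integral>\<^sup>+t. ennreal a * (ennreal (\<bar>g h (\<psi> h t) - k (\<psi> h t)\<bar> powr p) * indicator {0..1} t +
             ennreal a * (ennreal (\<bar>k (\<psi> h t) - k t\<bar> powr p) * indicator {0..1} t + ennreal (\<bar>v t - k t\<bar> powr p) * indicator {0..1} t)) \<partial>lborel)"
          using pt a by (intro nn_integral_mono) (auto simp: indicator_def simp flip: ennreal_plus ennreal_mult intro!: ennreal_leI)
        also have "\<dots> = ennreal a * (?A h + ennreal a * (?B h + ?E))"
          by (simp add: nn_integral_cmult nn_integral_add)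
        finally show ?thesis .
      qed
      have "(\<lambda>h. ennreal a * (?A h + ennreal a * (?B h + ?E))) \<longlonglongrightarrow> ennreal a * (?E + ennreal a * (0 + ?E))"
        by (intro ennreal_tendsto_cmult tendsto_add A cc[OF k(1,2)] tendsto_const) auto
      moreover have "ennreal a * (?E + ennreal a * (0 + ?E)) < ennreal a * (ennreal e' + ennreal a * ennreal e')"
        unfolding add_0 using a k(3) by (intro ennreal_mult_strict_left_mono add_strict_mono) auto
      moreover have "ennreal a * (ennreal e' + ennreal a * ennreal e') = ennreal (a * (e' + a * e'))"
        using a e' by (simp flip: ennreal_plus ennreal_mult)
      moreover have "a * (e' + a * e') = (a + a * a) * e'" by (simp add: algebra_simps)
      moreover have "a + a * a > 0" using a by (auto intro: add_pos_pos)
      then have "(a + a * a) * e' = e" by (simp add: e'_def)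
      ultimately have "\<forall>\<^sub>F h in sequentially. ennreal a * (?A h + ennreal a * (?B h + ?E)) < ennreal e"
        by (intro order_tendstoD(2)) auto
      then show "\<forall>\<^sub>F h in sequentially. (\<integral>\<^sup>+t\<in>{0..1}. ennreal (\<bar>g h (\<psi> h t) - v t\<bar> powr p) \<partial>lborel) < ennreal e"
        by eventually_elim (use bound le_less_trans in blast)
    qed
  qed
qed

section \<open>Passage from Borel representatives to the function spaces on the unit
  interval\<close>

text \<open>The functionals are written with \<open>lebesgue_on\<close> and \<open>deriv_on\<close>,
  the estimates with \<open>lborel\<close> and Borel representatives. Agreement almost everywhere is
  the right link because \<open>deriv_on\<close> is unspecified on a null set.\<close>

lemma nn_integral_lebesgue_on_eq:
  assumes "AE t in lborel. t \<in> S \<longrightarrow> f t = g t" and "S \<in> sets borel"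
  shows "(\<integral>\<^sup>+t. f t \<partial>lebesgue_on S) = (\<integral>\<^sup>+t\<in>S. g t \<partial>lborel)"
proof -
  have "S \<in> sets lebesgue" using assms(2) by (simp add: sets_completionI_sets)
  then have "(\<integral>\<^sup>+t. f t \<partial>lebesgue_on S) = (\<integral>\<^sup>+t. f t * indicator S t \<partial>lborel)"
    by (simp add: nn_integral_restrict_space nn_integral_completion)
  also have "AE t in lborel. f t * indicator S t = g t * indicator S t"
    using assms(1) by eventually_elim (auto simp: indicator_def)
  then have "(\<integral>\<^sup>+t. f t * indicator S t \<partial>lborel) = (\<integral>\<^sup>+t. g t * indicator S t \<partial>lborel)"
    by (rule nn_integral_cong_AE)
  finally show ?thesis .
qed

lemma measurable_lebesgue_on_AE:
  fixes f g :: "real \<Rightarrow> real"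
  assumes ae: "AE t in lborel. t \<in> S \<longrightarrow> f t = g t" and [measurable]: "S \<in> sets borel" "g \<in> borel_measurable borel"
  shows "f \<in> borel_measurable (lebesgue_on S)"
proof -
  have "(\<lambda>t. if t \<in> S then f t else 0) \<in> borel_measurable lebesgue"
  proof (rule borel_measurable_AE)
    show "(\<lambda>t. if t \<in> S then g t else 0) \<in> borel_measurable lebesgue"
      by (intro measurable_completion) simp
    have "AE t in lborel. (if t \<in> S then g t else 0) = (if t \<in> S then f t else 0)"
      using ae by eventually_elim auto
    then show "AE t in lebesgue. (if t \<in> S then g t else 0) = (if t \<in> S then f t else 0)"
      by (rule AE_completion)
  qed
  then show ?thesis
    using borel_measurable_if[of S f] assms(2) by (simp add: sets_completionI_sets)
qed

text \<open>\<open>u\<close> lives on the line and has a two-sided derivative, while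
  \<open>f\<close> agrees with it only on \<open>{0..1}\<close>; in this way \<open>y\<close> is
  exchanged for its primitive \<open>Y\<close>, end points included.\<close>

lemma deriv_on_eqI:
  assumes "(u has_real_derivative d) (at t)" "t \<in> {0..1}" "\<And>s. s \<in> {0..1} \<Longrightarrow> f s = u s"
  shows "deriv_on {0..1} f t = d"
proof -
  have "(u has_vector_derivative d) (at t within {0..1})"
    using assms(1) by (simp add: has_real_derivative_iff_has_vector_derivative has_vector_derivative_at_within)
  then have "(f has_vector_derivative d) (at t within {0..1})"
    using has_vector_derivative_transform[OF assms(2), of f u d] assms(3) by blast
  then show ?thesis
    unfolding deriv_on_def using assms(2) vector_derivative_within_cbox[of 0 1 t f d] by simp
qed

lemma lipschitz_on_imp_abs_continuous_on:
  fixes f :: "real \<Rightarrow> real"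
  assumes "C-lipschitz_on S f"
  shows "abs_continuous_on S f"
  unfolding abs_continuous_on_def
proof (intro allI impI)
  fix e :: real assume e: "e > 0"
  have C: "C \<ge> 0" by (rule lipschitz_on_nonneg[OF assms])
  show "\<exists>\<delta>>0. \<forall>D. finite D \<and> (\<forall>(a, b)\<in>D. a \<in> S \<and> b \<in> S \<and> a < b) \<and>
       disjoint_family_on (\<lambda>(a, b). {a<..<b}) D \<and> (\<Sum>(a, b)\<in>D. b - a) < \<delta> \<longrightarrow> (\<Sum>(a, b)\<in>D. \<bar>f b - f a\<bar>) < e"
  \<comment> \<open>The divisor is \<open>C + 1\<close> because \<open>C\<close> may be 0.\<close>
  proof (intro exI[of _ "e / (C + 1)"] conjI allI impI)
    show "e / (C + 1) > 0" using e C by simp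
    fix D assume D: "finite D \<and> (\<forall>(a, b)\<in>D. a \<in> S \<and> b \<in> S \<and> a < b) \<and>
       disjoint_family_on (\<lambda>(a, b). {a<..<b}) D \<and> (\<Sum>(a, b)\<in>D. b - a) < e / (C + 1)"
    have "(\<Sum>(a, b)\<in>D. \<bar>f b - f a\<bar>) \<le> (\<Sum>(a, b)\<in>D. (C + 1) * (b - a))"
    proof (rule sum_mono)
      fix i assume "i \<in> D"
      then have i: "fst i \<in> S" "snd i \<in> S" "fst i < snd i" using D by auto
      have "\<bar>f (snd i) - f (fst i)\<bar> \<le> C * (snd i - fst i)"
        using lipschitz_onD[OF assms i(2,1)] i(3) by (simp add: dist_real_def)
      also have "\<dots> \<le> (C + 1) * (snd i - fst i)" using i(3) by (intro mult_right_mono) auto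
      finally show "(case i of (a, b) \<Rightarrow> \<bar>f b - f a\<bar>) \<le> (case i of (a, b) \<Rightarrow> (C + 1) * (b - a))"
        by (simp add: case_prod_unfold)
    qed
    also have "\<dots> = (C + 1) * (\<Sum>(a, b)\<in>D. b - a)"
      by (simp add: sum_distrib_left case_prod_unfold)
    also have "\<dots> < (C + 1) * (e / (C + 1))" using D C by (intro mult_strict_left_mono) auto
    also have "\<dots> = e" using C by simp
    finally show "(\<Sum>(a, b)\<in>D. \<bar>f b - f a\<bar>) < e" .
  qed
qed

lemma Lp_norm_tendsto_0:
  assumes f: "\<And>h. f h \<in> borel_measurable (lebesgue_on S)" and p: "p > 0"
    and lim: "(\<lambda>h. \<integral>\<^sup>+t. ennreal (\<bar>f h t\<bar> powr p) \<partial>lebesgue_on S) \<longlonglongrightarrow> 0"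
  shows "(\<lambda>h. Lp_norm p S (f h)) \<longlonglongrightarrow> 0"
proof -
  have "(LINT t|lebesgue_on S. \<bar>f h t\<bar> powr p) = enn2real (\<integral>\<^sup>+t. ennreal (\<bar>f h t\<bar> powr p) \<partial>lebesgue_on S)" for h
    using f[of h] by (intro integral_eq_nn_integral) auto
  moreover have "(\<lambda>h. enn2real (\<integral>\<^sup>+t. ennreal (\<bar>f h t\<bar> powr p) \<partial>lebesgue_on S)) \<longlonglongrightarrow> 0"
    by (rule tendsto_enn2real) (use lim in auto)
  ultimately have "(\<lambda>h. LINT t|lebesgue_on S. \<bar>f h t\<bar> powr p) \<longlonglongrightarrow> 0" by simp
  then show ?thesis
    unfolding Lp_norm_def using p by (intro tendsto_zero_powrI[where b="1 / p"]) auto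
qed

text \<open>Applied to the two functions \<rho> on the compact range of \<open>y\<close>, this
  bounds the substitute slope \<open>q\<close> away from 0 and from infinity.\<close>

lemma nonzero_continuous_bounds:
  fixes r :: "real \<Rightarrow> real"
  assumes "compact S" "continuous_on S r" "\<And>z. z \<in> S \<Longrightarrow> r z \<noteq> 0"
  obtains c R where "0 < c" "\<And>z. z \<in> S \<Longrightarrow> c \<le> \<bar>r z\<bar> \<and> \<bar>r z\<bar> \<le> R"
proof (cases "S = {}")
  case True
  then show ?thesis using that[of 1 1] by simp
next
  case False
  have "continuous_on S (\<lambda>z. \<bar>r z\<bar>)" using assms(2) by (intro continuous_intros)
  then obtain a b where "a \<in> S" "\<And>z. z \<in> S \<Longrightarrow> \<bar>r a\<bar> \<le> \<bar>r z\<bar>" "b \<in> S" "\<And>z. z \<in> S \<Longrightarrow> \<bar>r z\<bar> \<le> \<bar>r b\<bar>"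
    using continuous_attains_inf[OF assms(1) False] continuous_attains_sup[OF assms(1) False] by metis
  then show ?thesis using that[of "\<bar>r a\<bar>" "\<bar>r b\<bar>"] assms(3) by auto
qed

theorem theorem4p1:
  fixes L :: "real \<times> real \<Rightarrow> ennreal"
    and p :: real
    and y \<rho>m \<rho>p :: "real \<Rightarrow> real"
  assumes "L \<in> borel_measurable borel"
    and "1 \<le> p"
    and "y \<in> W1 p {0..1}"
    and "y 0 = 0"
    and "action L y < \<infinity>"
    and "\<exists>C. C-lipschitz_on (y ` {0..1}) \<rho>m"
    and "\<exists>C. C-lipschitz_on (y ` {0..1}) \<rho>p"
    and "\<forall>z \<in> y ` {0..1}. \<rho>m z < 0 \<and> \<rho>p z > 0"
    and "(SUP z \<in> y ` {0..1}. L (z, \<rho>m z)) < \<infinity>"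
    and "(SUP z \<in> y ` {0..1}. L (z, \<rho>p z)) < \<infinity>"
  shows "\<exists>ys :: nat \<Rightarrow> real \<Rightarrow> real.
           (\<forall>h. (\<exists>C. C-lipschitz_on {0..1} (ys h)) \<and> ys h 0 = 0) \<and>
           (\<lambda>h. action L (ys h)) \<longlonglongrightarrow> action L y \<and>
           W1_tendsto p {0..1} ys y"
proof -
  have ac: "abs_continuous_on {0..1} y" using assms(3) by (simp add: W1_def)
  obtain v where v: "integrable lborel v" "\<And>x. x \<notin> {0<..1} \<Longrightarrow> v x = 0"
    "\<And>t. t \<in> {0..1} \<Longrightarrow> y t - y 0 = (LINT s:{..t}|lborel. v s)"
    using abs_continuous_on_density[OF ac] by blast
  define Y where "Y t = (LINT s:{..t}|lborel. v s)" for t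
  have yY: "y t = Y t" if "t \<in> {0..1}" for t using v(3)[OF that] assms(4) by (simp add: Y_def)
  have [measurable]: "v \<in> borel_measurable borel" using borel_measurable_integrable[OF v(1)] by simp
  have Yder: "AE t in lborel. (Y has_real_derivative v t) (at t)"
    unfolding Y_def by (rule Lebesgue_differentiation[OF v(1)])
  then have yder: "AE t in lborel. t \<in> {0..1} \<longrightarrow> deriv_on {0..1} y t = v t"
    by eventually_elim (auto intro!: deriv_on_eqI[where u=Y] yY)
  have ycont: "continuous_on {0..1} y" by (rule abs_continuous_on_imp_continuous_on[OF ac])
  have comp: "compact (y ` {0..1})" by (rule compact_continuous_image[OF ycont]) simp
  have rcont: "continuous_on (y ` {0..1}) \<rho>m" "continuous_on (y ` {0..1}) \<rho>p"
    using assms(6,7) lipschitz_on_continuous_on by blast+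
  obtain c1 R1 where m: "0 < c1" "\<And>z. z \<in> y ` {0..1} \<Longrightarrow> c1 \<le> \<bar>\<rho>m z\<bar> \<and> \<bar>\<rho>m z\<bar> \<le> R1"
    using nonzero_continuous_bounds[OF comp rcont(1)] assms(8) by (metis order_less_irrefl)
  obtain c2 R2 where pp: "0 < c2" "\<And>z. z \<in> y ` {0..1} \<Longrightarrow> c2 \<le> \<bar>\<rho>p z\<bar> \<and> \<bar>\<rho>p z\<bar> \<le> R2"
    using nonzero_continuous_bounds[OF comp rcont(2)] assms(8) by (metis order_less_irrefl)
  \<comment> \<open>The functions \<rho> are controlled only on the range of \<open>y\<close>;
    clamping the time keeps \<open>q\<close> bounded and Borel on the whole line.\<close>
  define cl :: "real \<Rightarrow> real" where "cl s = max 0 (min s 1)" for s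
  have cl: "cl s \<in> {0..1}" "s \<in> {0..1} \<Longrightarrow> cl s = s" for s by (auto simp: cl_def)
  have "continuous_on UNIV cl" unfolding cl_def by (intro continuous_intros)
  then have ycl: "continuous_on UNIV (\<lambda>s. y (cl s))"
    by (rule continuous_on_compose2[OF ycont]) (use cl in auto)
  have [measurable]: "(\<lambda>s. \<rho>m (y (cl s))) \<in> borel_measurable borel" "(\<lambda>s. \<rho>p (y (cl s))) \<in> borel_measurable borel"
    by (auto intro!: borel_measurable_continuous_onI continuous_on_compose2[OF rcont(1) ycl] continuous_on_compose2[OF rcont(2) ycl] cl(1))
  \<comment> \<open>The sign of \<open>v s\<close> selects the function, so that
    \<open>v s / q s\<close> is positive wherever \<open>v s\<close> is nonzero.\<close>
  define q where "q s = (if v s > 0 then \<rho>p (y (cl s)) else \<rho>m (y (cl s)))" for s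
  have q[measurable]: "q \<in> borel_measurable borel" unfolding q_def by measurable
  have yc: "y (cl s) \<in> y ` {0..1}" for s using cl(1) by blast
  define C where "C = max (SUP z \<in> y ` {0..1}. L (z, \<rho>m z)) (SUP z \<in> y ` {0..1}. L (z, \<rho>p z))"
  have actY: "action L y = (\<integral>\<^sup>+t\<in>{0..1}. L (Y t, v t) \<partial>lborel)"
    unfolding action_def
    by (rule nn_integral_lebesgue_on_eq) (use yder yY in \<open>auto elim: eventually_mono\<close>)
  have vp: "(\<integral>\<^sup>+t\<in>{0..1}. ennreal (\<bar>v t\<bar> powr p) \<partial>lborel) < \<infinity>"
  proof -
    have "(\<integral>\<^sup>+t\<in>{0..1}. ennreal (\<bar>v t\<bar> powr p) \<partial>lborel) = (\<integral>\<^sup>+t. ennreal (\<bar>deriv_on {0..1} y t\<bar> powr p) \<partial>lebesgue_on {0..1})"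
      by (rule nn_integral_lebesgue_on_eq[symmetric]) (use yder in \<open>auto elim: eventually_mono\<close>)
    also have "\<dots> < \<infinity>"
      using assms(3) by (auto simp: W1_def Lp_on_def nn_integral_eq_integral)
    finally show ?thesis .
  qed
  obtain u d B where u: "\<And>h. (B h)-lipschitz_on {0..1} (u h)" "\<And>h. u h 0 = 0"
    and dm: "\<And>h. d h \<in> borel_measurable borel"
    and ud: "\<And>h. AE t in lborel. (u h has_real_derivative d h t) (at t)"
    and dB: "\<And>h t. \<bar>d h t\<bar> \<le> B h"
    and lims: "(\<lambda>h. \<integral>\<^sup>+t\<in>{0..1}. L (u h t, d h t) \<partial>lborel) \<longlonglongrightarrow> (\<integral>\<^sup>+t\<in>{0..1}. L (Y t, v t) \<partial>lborel)"
      "(\<lambda>h. \<integral>\<^sup>+t\<in>{0..1}. ennreal (\<bar>u h t - Y t\<bar> powr p) \<partial>lborel) \<longlonglongrightarrow> 0"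
      "(\<lambda>h. \<integral>\<^sup>+t\<in>{0..1}. ennreal (\<bar>d h t - v t\<bar> powr p) \<partial>lborel) \<longlonglongrightarrow> 0"
  proof (rule Lipschitz_approximation[of L q p v "min c1 c2" "max R1 R2" C, folded Y_def])
    show "min c1 c2 \<le> \<bar>q s\<bar>" "\<bar>q s\<bar> \<le> max R1 R2" for s
      using m(2)[OF yc[of s]] pp(2)[OF yc[of s]] by (auto simp: q_def)
    show "0 < v s * q s" if "v s \<noteq> 0" for s
      using that assms(8) yc[of s] by (auto simp: q_def zero_less_mult_iff)
    show "C < \<infinity>" using assms(9,10) by (simp add: C_def)
    show "L (Y s, q s) \<le> C" if s: "s \<in> {0..1}" for s
    proof -
      have "L (y s, \<rho>m (y s)) \<le> (SUP z \<in> y ` {0..1}. L (z, \<rho>m z))" "L (y s, \<rho>p (y s)) \<le> (SUP z \<in> y ` {0..1}. L (z, \<rho>p z))"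
        by (rule SUP_upper[OF imageI[OF s], of "\<lambda>z. L (z, \<rho>m z)" y] SUP_upper[OF imageI[OF s], of "\<lambda>z. L (z, \<rho>p z)" y])+
      then have "L (y s, \<rho>m (y s)) \<le> C" "L (y s, \<rho>p (y s)) \<le> C"
        unfolding C_def by (simp_all add: le_max_iff_disj)
      then show ?thesis using yY[OF s] cl(2)[OF s] by (simp add: q_def)
    qed
  qed (use assms(1,2,5) q v(1,2) vp actY m(1) pp(1) in auto)
  have ud0: "AE t in lborel. t \<in> {0..1} \<longrightarrow> deriv_on {0..1} (u h) t = d h t" for h
    using ud[of h] by eventually_elim (auto intro!: deriv_on_eqI)
  \<comment> \<open>The difference is differentiated as \<open>u h t - Y t\<close> on the line and
    then transferred, since \<open>y\<close> is controlled only on \<open>{0..1}\<close>.\<close>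
  have udy: "AE t in lborel. t \<in> {0..1} \<longrightarrow> deriv_on {0..1} (\<lambda>t. u h t - y t) t = d h t - v t" for h
    using ud[of h] Yder
    by eventually_elim (auto intro!: deriv_on_eqI[where u="\<lambda>t. u h t - Y t"] derivative_intros simp: yY)
  have act: "action L (u h) = (\<integral>\<^sup>+t\<in>{0..1}. L (u h t, d h t) \<partial>lborel)" for h
    unfolding action_def
    by (rule nn_integral_lebesgue_on_eq) (use ud0[of h] in \<open>auto elim: eventually_mono\<close>)
  \<comment> \<open>Membership is part of \<open>W1_tendsto\<close>; the bound \<open>B h\<close> on
    the derivative makes its \<open>p\<close>-th power integrable on \<open>{0..1}\<close>.\<close>
  have uW: "u h \<in> W1 p {0..1}" for h
  proof -
    have meas: "deriv_on {0..1} (u h) \<in> borel_measurable (lebesgue_on {0..1})"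
      by (rule measurable_lebesgue_on_AE[OF ud0]) (use dm in auto)
    have "(\<integral>\<^sup>+t. ennreal (\<bar>deriv_on {0..1} (u h) t\<bar> powr p) \<partial>lebesgue_on {0..1}) = (\<integral>\<^sup>+t\<in>{0..1}. ennreal (\<bar>d h t\<bar> powr p) \<partial>lborel)"
      by (rule nn_integral_lebesgue_on_eq) (use ud0[of h] in \<open>auto elim: eventually_mono\<close>)
    also have "\<dots> \<le> (\<integral>\<^sup>+t\<in>{0..1::real}. ennreal (B h powr p) \<partial>lborel)"
      by (intro nn_integral_mono mult_right_mono ennreal_leI powr_mono2) (use dB assms(2) in auto)
    also have "\<dots> < \<infinity>" by (simp add: nn_integral_cmult)
    finally have "integrable (lebesgue_on {0..1}) (\<lambda>t. \<bar>deriv_on {0..1} (u h) t\<bar> powr p)"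
      using meas by (intro integrableI_nonneg) auto
    then show ?thesis
      using lipschitz_on_imp_abs_continuous_on[OF u(1)] meas by (simp add: W1_def Lp_on_def)
  qed
  have "(\<lambda>h. Lp_norm p {0..1} (\<lambda>t. u h t - y t)) \<longlonglongrightarrow> 0"
  proof (rule Lp_norm_tendsto_0)
    fix h
    have "continuous_on {0..1} (\<lambda>t. u h t - y t)"
      using lipschitz_on_continuous_on[OF u(1)] ycont by (intro continuous_intros)
    then show "(\<lambda>t. u h t - y t) \<in> borel_measurable (lebesgue_on {0..1})"
      by (rule continuous_imp_measurable_on_sets_lebesgue) simp
  next
    have "(\<integral>\<^sup>+t. ennreal (\<bar>u h t - y t\<bar> powr p) \<partial>lebesgue_on {0..1}) = (\<integral>\<^sup>+t\<in>{0..1}. ennreal (\<bar>u h t - Y t\<bar> powr p) \<partial>lborel)" for h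
      by (rule nn_integral_lebesgue_on_eq) (auto simp: yY)
    then show "(\<lambda>h. \<integral>\<^sup>+t. ennreal (\<bar>u h t - y t\<bar> powr p) \<partial>lebesgue_on {0..1}) \<longlonglongrightarrow> 0" using lims(2) by simp
  qed (use assms(2) in auto)
  moreover have "(\<lambda>h. Lp_norm p {0..1} (deriv_on {0..1} (\<lambda>t. u h t - y t))) \<longlonglongrightarrow> 0"
  proof (rule Lp_norm_tendsto_0)
    show "deriv_on {0..1} (\<lambda>t. u h t - y t) \<in> borel_measurable (lebesgue_on {0..1})" for h
      by (rule measurable_lebesgue_on_AE[OF udy]) (use dm in auto)
    have "(\<integral>\<^sup>+t. ennreal (\<bar>deriv_on {0..1} (\<lambda>t. u h t - y t) t\<bar> powr p) \<partial>lebesgue_on {0..1}) = (\<integral>\<^sup>+t\<in>{0..1}. ennreal (\<bar>d h t - v t\<bar> powr p) \<partial>lborel)" for h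
      by (rule nn_integral_lebesgue_on_eq) (use udy[of h] in \<open>auto elim: eventually_mono\<close>)
    then show "(\<lambda>h. \<integral>\<^sup>+t. ennreal (\<bar>deriv_on {0..1} (\<lambda>t. u h t - y t) t\<bar> powr p) \<partial>lebesgue_on {0..1}) \<longlonglongrightarrow> 0" using lims(3) by simp
  qed (use assms(2) in auto)
  ultimately have "(\<lambda>h. W1_norm p {0..1} (\<lambda>t. u h t - y t)) \<longlonglongrightarrow> 0 + 0"
    unfolding W1_norm_def by (rule tendsto_add)
  then have "W1_tendsto p {0..1} u y"
    using assms(3) uW by (simp add: W1_tendsto_def)
  moreover have "(\<lambda>h. action L (u h)) \<longlonglongrightarrow> action L y" using lims(1) by (simp add: act actY)
  ultimately show ?thesis using u by blast
qed

end
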